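(* For generic $V$ in the space of all real-valued limit-periodic sequences on $\mathbb{Z}$ with the $\ell^\infty$ metric (that is, for all $V$ in some dense $G_\delta$ subset of this space), the discrete Schrödinger operator $H=\Delta+V$ on $\ell^2(\mathbb{Z})$ satisfies $\beta^+_\psi(p)=1$ for all $p>0$ and all exponentially decaying $\psi\in\ell^2(\mathbb{Z})\setminus\{0\}$.
   Context: A sequence $V:\mathbb{Z}\to\mathbb{R}$ is limit-periodic if it is a limit in $\ell^\infty(\mathbb{Z})$ of periodic sequences. $\Delta$ is the discrete Laplacian, $(\Delta u)(n)=u(n+1)+u(n-1)$, and $V$ acts by multiplication. $\psi$ decays exponentially if $|\psi(n)|\le Ke^{-c|n|}$ for all $n$, for some $K,c>0$. With $(|X|^pu)(n)=|n|^pu(n)$ and $\psi(t)=e^{-itH}\psi$, $\beta^+_\psi(p)=\limsup_{t\to\infty}\frac{\log\langle\psi(t),|X|^p\psi(t)\rangle}{p\log t}$. *)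

theory Defs
  imports "HOL-Analysis.Analysis"
begin

section \<open>The Hilbert space of square-summable sequences\<close>

typedef ell2 = "{u :: int \<Rightarrow> complex. (\<lambda>n. (cmod (u n))\<^sup>2) summable_on UNIV}"
  morphisms ell2_nth Abs_ell2
  by (rule exI[of _ "\<lambda>_. 0"]) simp

setup_lifting type_definition_ell2

lemma ell2_eqI: "(\<And>n. ell2_nth u n = ell2_nth v n) \<Longrightarrow> u = v"
  by transfer auto

lemma ell2_summable: "(\<lambda>n. (cmod (ell2_nth u n))\<^sup>2) summable_on UNIV"
  using ell2_nth[of u] by simp

lemma sq_summable_dominated:
  fixes f :: "int \<Rightarrow> real"
  assumes "f summable_on UNIV" "\<And>n. (cmod (u n))\<^sup>2 \<le> f n"
  shows "(\<lambda>n. (cmod (u n))\<^sup>2) summable_on UNIV"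
  by (rule summable_on_comparison_test[OF assms(1)]) (use assms(2) in auto)

lemma sq_summable_add:
  assumes "(\<lambda>n. (cmod (u n))\<^sup>2) summable_on UNIV" "(\<lambda>n. (cmod (v n))\<^sup>2) summable_on UNIV"
  shows "(\<lambda>n::int. (cmod (u n + v n))\<^sup>2) summable_on UNIV"
proof (rule sq_summable_dominated)
  show "(\<lambda>n. 2 * (cmod (u n))\<^sup>2 + 2 * (cmod (v n))\<^sup>2) summable_on UNIV"
    by (intro summable_on_add summable_on_cmult_right assms)
  show "(cmod (u n + v n))\<^sup>2 \<le> 2 * (cmod (u n))\<^sup>2 + 2 * (cmod (v n))\<^sup>2" for n
  proof -
    have "(cmod (u n + v n))\<^sup>2 \<le> (cmod (u n) + cmod (v n))\<^sup>2"
      by (intro power_mono norm_triangle_ineq) auto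
    also have "\<dots> \<le> 2 * (cmod (u n))\<^sup>2 + 2 * (cmod (v n))\<^sup>2"
      using zero_le_power2[of "cmod (u n) - cmod (v n)"] by (simp add: power2_eq_square algebra_simps)
    finally show ?thesis .
  qed
qed

lemma sq_summable_mult:
  assumes "(\<lambda>n. (cmod (u n))\<^sup>2) summable_on UNIV" "\<And>n. cmod (c n) \<le> B"
  shows "(\<lambda>n::int. (cmod (c n * u n))\<^sup>2) summable_on UNIV"
proof (rule sq_summable_dominated)
  show "(\<lambda>n. B\<^sup>2 * (cmod (u n))\<^sup>2) summable_on UNIV"
    by (intro summable_on_cmult_right assms)
  show "(cmod (c n * u n))\<^sup>2 \<le> B\<^sup>2 * (cmod (u n))\<^sup>2" for n
    using assms(2)[of n] by (auto simp: norm_mult power_mult_distrib intro!: mult_right_mono power_mono)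
qed

lemma sq_summable_shift:
  assumes "(\<lambda>n. (cmod (u n))\<^sup>2) summable_on UNIV"
  shows "(\<lambda>n::int. (cmod (u (n + k)))\<^sup>2) summable_on UNIV"
proof -
  have "bij_betw (\<lambda>n::int. n + k) UNIV UNIV"
    by (rule bij_betwI[where g = "\<lambda>n. n - k"]) auto
  from summable_on_reindex_bij_betw[OF this, of "\<lambda>n. (cmod (u n))\<^sup>2"] assms show ?thesis by simp
qed

instantiation ell2 :: real_vector
begin
lift_definition zero_ell2 :: ell2 is "\<lambda>_. 0" by simp
lift_definition plus_ell2 :: "ell2 \<Rightarrow> ell2 \<Rightarrow> ell2" is "\<lambda>u v n. u n + v n"
  by (rule sq_summable_add)
lift_definition uminus_ell2 :: "ell2 \<Rightarrow> ell2" is "\<lambda>u n. - u n" by simp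
definition minus_ell2 :: "ell2 \<Rightarrow> ell2 \<Rightarrow> ell2" where "minus_ell2 u v = u + - v"
lift_definition scaleR_ell2 :: "real \<Rightarrow> ell2 \<Rightarrow> ell2" is "\<lambda>a u n. complex_of_real a * u n"
  by (rule sq_summable_mult) auto
instance
  by standard (unfold minus_ell2_def, (transfer, auto simp: fun_eq_iff algebra_simps)+)
end

lemma ell2_nth_simps [simp]:
  "ell2_nth 0 n = 0" "ell2_nth (u + v) n = ell2_nth u n + ell2_nth v n"
  "ell2_nth (- u) n = - ell2_nth u n" "ell2_nth (u - v) n = ell2_nth u n - ell2_nth v n"
  "ell2_nth (a *\<^sub>R u) n = complex_of_real a * ell2_nth u n"
  unfolding minus_ell2_def by (transfer, simp)+

text \<open>The inner product \<open>\<Sum>\<^sub>n cnj (u n) * v n\<close>, for arbitrary sequences because it is also used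
  for pairs \<open>\<psi>, |X|\<^sup>p \<psi>\<close>.\<close>

definition seq_inner :: "(int \<Rightarrow> complex) \<Rightarrow> (int \<Rightarrow> complex) \<Rightarrow> complex" where
  "seq_inner u v = (\<Sum>\<^sub>\<infinity>n. cnj (u n) * v n)"

instantiation ell2 :: real_normed_vector
begin
definition norm_ell2 :: "ell2 \<Rightarrow> real" where
  "norm_ell2 u = sqrt (\<Sum>\<^sub>\<infinity>n. (cmod (ell2_nth u n))\<^sup>2)"
definition dist_ell2 :: "ell2 \<Rightarrow> ell2 \<Rightarrow> real" where "dist_ell2 u v = norm (u - v)"
definition sgn_ell2 :: "ell2 \<Rightarrow> ell2" where "sgn_ell2 u = u /\<^sub>R norm u"
definition uniformity_ell2 :: "(ell2 \<times> ell2) filter" where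
  "uniformity_ell2 = (INF e\<in>{0<..}. principal {(x, y). dist x y < e})"
definition open_ell2 :: "ell2 set \<Rightarrow> bool" where
  "open_ell2 U = (\<forall>x\<in>U. \<forall>\<^sub>F (x', y) in uniformity. x' = x \<longrightarrow> y \<in> U)"

lemma L2_set_le_norm_ell2:
  assumes "finite F" shows "L2_set (\<lambda>n. cmod (ell2_nth u n)) F \<le> norm u"
  unfolding L2_set_def norm_ell2_def
  by (intro real_sqrt_le_mono finite_sum_le_infsum ell2_summable assms) auto

lemma norm_ell2_leI:
  assumes "\<And>F. finite F \<Longrightarrow> L2_set (\<lambda>n. cmod (ell2_nth u n)) F \<le> B"
  shows "norm u \<le> B"
proof -
  have B: "0 \<le> B" using assms[of "{}"] by simp
  have "(\<Sum>n\<in>F. (cmod (ell2_nth u n))\<^sup>2) \<le> B\<^sup>2" if "finite F" for F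
    using assms[OF that] unfolding L2_set_def by (rule sqrt_le_D)
  hence "(\<Sum>\<^sub>\<infinity>n. (cmod (ell2_nth u n))\<^sup>2) \<le> B\<^sup>2"
    by (intro infsum_le_finite_sums ell2_summable) auto
  thus ?thesis unfolding norm_ell2_def using B by (simp add: real_le_lsqrt infsum_nonneg)
qed

lemma norm_nth_ell2: "cmod (ell2_nth u n) \<le> norm u"
  using L2_set_le_norm_ell2[of "{n}" u] by simp

instance
proof
  fix u v :: ell2 and a :: real
  show "dist u v = norm (u - v)" by (fact dist_ell2_def)
  show "sgn u = u /\<^sub>R norm u" by (fact sgn_ell2_def)
  show "uniformity = (INF e\<in>{0<..}. principal {(x::ell2, y). dist x y < e})"
    by (fact uniformity_ell2_def)
  show "open U \<longleftrightarrow> (\<forall>x\<in>U. \<forall>\<^sub>F (x', y) in uniformity. x' = x \<longrightarrow> y \<in> U)" for U :: "ell2 set"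
    by (fact open_ell2_def)
  show "norm u = 0 \<longleftrightarrow> u = 0"
  proof
    assume "norm u = 0"
    thus "u = 0" using norm_nth_ell2[of u] by (intro ell2_eqI) auto
  qed (simp add: norm_ell2_def)
  show "norm (u + v) \<le> norm u + norm v"
  proof (rule norm_ell2_leI)
    fix F :: "int set" assume F: "finite F"
    have "L2_set (\<lambda>n. cmod (ell2_nth (u + v) n)) F
        \<le> L2_set (\<lambda>n. cmod (ell2_nth u n) + cmod (ell2_nth v n)) F"
      by (intro L2_set_mono) (auto simp: norm_triangle_ineq)
    also have "\<dots> \<le> L2_set (\<lambda>n. cmod (ell2_nth u n)) F + L2_set (\<lambda>n. cmod (ell2_nth v n)) F"
      by (rule L2_set_triangle_ineq)
    finally show "L2_set (\<lambda>n. cmod (ell2_nth (u + v) n)) F \<le> norm u + norm v"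
      using L2_set_le_norm_ell2[OF F, of u] L2_set_le_norm_ell2[OF F, of v] by linarith
  qed
  show "norm (a *\<^sub>R u) = \<bar>a\<bar> * norm u"
    unfolding norm_ell2_def
    by (simp add: norm_mult power_mult_distrib infsum_cmult_right' real_sqrt_mult)
qed
end

lemma norm_ell2_eq_seq_inner:
  "complex_of_real ((norm u)\<^sup>2) = seq_inner (ell2_nth u) (ell2_nth u)"
proof -
  have "seq_inner (ell2_nth u) (ell2_nth u) = (\<Sum>\<^sub>\<infinity>n. complex_of_real ((cmod (ell2_nth u n))\<^sup>2))"
    unfolding seq_inner_def by (intro infsum_cong) (simp only: complex_norm_square mult.commute)
  also have "\<dots> = complex_of_real (\<Sum>\<^sub>\<infinity>n. (cmod (ell2_nth u n))\<^sup>2)"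
    by (metis ell2_summable has_sum_infsum has_sum_of_real infsumI)
  finally show ?thesis by (simp add: norm_ell2_def infsum_nonneg)
qed

lemma bounded_linear_ell2_nth: "bounded_linear (\<lambda>u. ell2_nth u n)"
  by (rule bounded_linear_intro[where K = 1]) (auto simp: scaleR_conv_of_real norm_nth_ell2)

instance ell2 :: banach
proof
  fix X :: "nat \<Rightarrow> ell2" assume X: "Cauchy X"
  have "\<exists>l. (\<lambda>k. ell2_nth (X k) n) \<longlonglongrightarrow> l" for n
    using bounded_linear.Cauchy[OF bounded_linear_ell2_nth X, of n]
    by (simp add: Cauchy_convergent_iff convergent_def)
  then obtain L where L: "\<And>n. (\<lambda>k. ell2_nth (X k) n) \<longlonglongrightarrow> L n" by metis
  have tail: "L2_set (\<lambda>n. cmod (ell2_nth (X k) n - L n)) F \<le> e"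
    if "finite F" "\<And>m. m \<ge> M \<Longrightarrow> norm (X k - X m) \<le> e" for k F M e
  proof (rule tendsto_upperbound)
    show "(\<lambda>m. L2_set (\<lambda>n. cmod (ell2_nth (X k) n - ell2_nth (X m) n)) F)
        \<longlonglongrightarrow> L2_set (\<lambda>n. cmod (ell2_nth (X k) n - L n)) F"
      unfolding L2_set_def by (intro tendsto_intros L)
    show "\<forall>\<^sub>F m in sequentially. L2_set (\<lambda>n. cmod (ell2_nth (X k) n - ell2_nth (X m) n)) F \<le> e"
      using L2_set_le_norm_ell2[OF that(1)] that(2)
      by (intro eventually_sequentiallyI[of M]) (metis (no_types, lifting) ell2_nth_simps(4) L2_set_cong order_trans)
  qed simp
  obtain M where M: "\<And>k m. k \<ge> M \<Longrightarrow> m \<ge> M \<Longrightarrow> norm (X k - X m) < 1"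
    using X unfolding Cauchy_iff by (metis zero_less_one)
  have "(\<lambda>n. (cmod (ell2_nth (X M) n - L n))\<^sup>2) summable_on UNIV"
  proof (rule nonneg_bdd_above_summable_on)
    have "(\<Sum>n\<in>F. (cmod (ell2_nth (X M) n - L n))\<^sup>2) \<le> 1\<^sup>2" if "finite F" for F
      using tail[OF that, of M M 1] M[of M] unfolding L2_set_def
      by (intro sqrt_le_D) (auto intro: less_imp_le)
    thus "bdd_above (sum (\<lambda>n. (cmod (ell2_nth (X M) n - L n))\<^sup>2) ` {F. F \<subseteq> UNIV \<and> finite F})"
      by (intro bdd_aboveI[of _ 1]) auto
  qed auto
  hence "(\<lambda>n. (cmod (ell2_nth (X M) n + - (ell2_nth (X M) n - L n)))\<^sup>2) summable_on UNIV"
    by (intro sq_summable_add ell2_summable) (simp add: norm_minus_commute)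
  hence "L \<in> {u. (\<lambda>n. (cmod (u n))\<^sup>2) summable_on UNIV}" by simp
  then obtain l where l: "L = ell2_nth l" by (metis Abs_ell2_inverse)
  have "X \<longlonglongrightarrow> l"
  proof (rule LIMSEQ_I)
    fix r :: real assume r: "r > 0"
    then obtain N where N: "\<And>k m. k \<ge> N \<Longrightarrow> m \<ge> N \<Longrightarrow> norm (X k - X m) < r / 2"
      using X unfolding Cauchy_iff by (metis half_gt_zero)
    have "norm (X k - l) \<le> r / 2" if "k \<ge> N" for k
      by (rule norm_ell2_leI, use tail[of _ N k "r / 2"] N that l in \<open>auto intro: less_imp_le\<close>)
    thus "\<exists>no. \<forall>k\<ge>no. norm (X k - l) < r" using r by (intro exI[of _ N]) force
  qed
  thus "convergent X" by (auto simp: convergent_def)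
qed

lift_definition scaleC_ell2 :: "complex \<Rightarrow> ell2 \<Rightarrow> ell2" (infixr \<open>*\<^sub>C\<close> 75)
  is "\<lambda>c u n. c * u n"
  by (rule sq_summable_mult) auto

lemma norm_scaleC_ell2: "norm (c *\<^sub>C u) = cmod c * norm u"
  unfolding norm_ell2_def
  by transfer (simp add: norm_mult power_mult_distrib infsum_cmult_right' real_sqrt_mult)


section \<open>Limit-periodic potentials\<close>

text \<open>Since \<open>int\<close> carries the discrete topology, \<open>int \<Rightarrow>\<^sub>C real\<close> is the space of all bounded real
  sequences on the integers, and its library metric is the supremum metric.\<close>

lemma bcontfun_int_iff: "(V :: int \<Rightarrow> real) \<in> bcontfun \<longleftrightarrow> bounded (range V)"
  by (simp add: bcontfun_def continuous_on_discrete)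

definition periodic :: "(int \<Rightarrow>\<^sub>C real) \<Rightarrow> bool" where
  "periodic V \<longleftrightarrow> (\<exists>q>0. \<forall>n. apply_bcontfun V (n + q) = apply_bcontfun V n)"

definition limit_periodic :: "(int \<Rightarrow>\<^sub>C real) set" where
  "limit_periodic = {V. \<exists>W :: nat \<Rightarrow> int \<Rightarrow>\<^sub>C real. (\<forall>k. periodic (W k)) \<and> W \<longlonglongrightarrow> V}"


section \<open>Schroedinger operators and quantum dynamics\<close>

lift_definition laplacian :: "ell2 \<Rightarrow> ell2" is "\<lambda>u n. u (n + 1) + u (n - 1)"
  using sq_summable_add[OF sq_summable_shift[of _ 1] sq_summable_shift[of _ "- 1"]] by simp

lift_definition mult_op :: "(int \<Rightarrow>\<^sub>C real) \<Rightarrow> ell2 \<Rightarrow> ell2"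
  is "\<lambda>V u n. complex_of_real (apply_bcontfun V n) * u n"
proof -
  fix V :: "int \<Rightarrow>\<^sub>C real" and u :: "int \<Rightarrow> complex"
  assume u: "(\<lambda>n. (cmod (u n))\<^sup>2) summable_on UNIV"
  show "(\<lambda>n. (cmod (complex_of_real (V n) * u n))\<^sup>2) summable_on UNIV"
    by (rule sq_summable_mult[OF u, of _ "norm V"]) (use norm_bounded[of V] in simp)
qed

definition schroedinger :: "(int \<Rightarrow>\<^sub>C real) \<Rightarrow> ell2 \<Rightarrow> ell2" where
  "schroedinger V u = laplacian u + mult_op V u"

text \<open>For bounded \<open>A\<close> the exponential series converges in norm, see \<open>summable_op_exp\<close>.\<close>

definition op_exp :: "(ell2 \<Rightarrow> ell2) \<Rightarrow> ell2 \<Rightarrow> ell2" where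
  "op_exp A u = (\<Sum>k. (A ^^ k) u /\<^sub>R fact k)"

definition evolution :: "(int \<Rightarrow>\<^sub>C real) \<Rightarrow> real \<Rightarrow> ell2 \<Rightarrow> ell2" where
  "evolution V t = op_exp (\<lambda>u. (- \<i> * complex_of_real t) *\<^sub>C schroedinger V u)"

definition exp_decaying :: "ell2 \<Rightarrow> bool" where
  "exp_decaying u \<longleftrightarrow>
    (\<exists>K>0. \<exists>c>0. \<forall>n. cmod (ell2_nth u n) \<le> K * exp (- c * \<bar>real_of_int n\<bar>))"

definition position_power :: "real \<Rightarrow> (int \<Rightarrow> complex) \<Rightarrow> int \<Rightarrow> complex" where
  "position_power p u n = complex_of_real (\<bar>real_of_int n\<bar> powr p) * u n"

text \<open>The sum converges, and its value is real, for the states that matter, see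
  \<open>moment_evolution\<close>.\<close>

definition moment :: "real \<Rightarrow> ell2 \<Rightarrow> real" where
  "moment p u = Re (seq_inner (ell2_nth u) (position_power p (ell2_nth u)))"

text \<open>Unlike \<open>ln\<close>, this has \<open>log 0 = - \<infinity>\<close>; a moment can vanish when \<open>\<psi>(t)\<close> is supported
  at the origin.\<close>

definition log_ereal :: "real \<Rightarrow> ereal" where
  "log_ereal x = (if x > 0 then ereal (ln x) else - \<infinity>)"

definition beta_upper :: "(int \<Rightarrow>\<^sub>C real) \<Rightarrow> ell2 \<Rightarrow> real \<Rightarrow> ereal" where
  "beta_upper V \<psi> p =
    Limsup at_top (\<lambda>t. log_ereal (moment p (evolution V t \<psi>)) / ereal (p * ln t))"


section \<open>Convergence of the sums above\<close>

lemma summable_op_exp: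
  fixes A :: "ell2 \<Rightarrow> ell2"
  assumes A: "\<And>u. norm (A u) \<le> B * norm u" and B: "B \<ge> 0"
  shows "summable (\<lambda>k. (A ^^ k) u /\<^sub>R fact k)"
proof (rule summable_comparison_test')
  have le: "norm ((A ^^ k) u) \<le> B ^ k * norm u" for k
  proof (induction k)
    case (Suc k)
    have "norm ((A ^^ Suc k) u) \<le> B * norm ((A ^^ k) u)" using A by simp
    also have "\<dots> \<le> B * (B ^ k * norm u)" using Suc B by (intro mult_left_mono)
    finally show ?case by (simp add: mult.assoc)
  qed simp
  show "summable (\<lambda>k. inverse (fact k) * B ^ k * norm u)"
    by (intro summable_mult2 summable_exp)
  show "norm ((A ^^ k) u /\<^sub>R fact k) \<le> inverse (fact k) * B ^ k * norm u" if "k \<ge> 0" for k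
    using le[of k] by (simp add: mult.assoc mult_left_mono)
qed

lemma ell2_nth_ops [simp]:
  "ell2_nth (c *\<^sub>C u) n = c * ell2_nth u n"
  "ell2_nth (laplacian u) n = ell2_nth u (n + 1) + ell2_nth u (n - 1)"
  "ell2_nth (mult_op V u) n = complex_of_real (apply_bcontfun V n) * ell2_nth u n"
  by (transfer, simp)+

lemma norm_schroedinger_le: "norm (schroedinger V u) \<le> (2 + norm V) * norm u"
proof -
  have shift: "L2_set (\<lambda>n. cmod (ell2_nth u (n + k))) F \<le> norm u" if "finite F" for F k
  proof -
    have "L2_set (\<lambda>n. cmod (ell2_nth u (n + k))) F = L2_set (\<lambda>n. cmod (ell2_nth u n)) ((\<lambda>n. n + k) ` F)"
      unfolding L2_set_def by (subst sum.reindex) (auto simp: inj_on_def)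
    thus ?thesis using L2_set_le_norm_ell2[of "(\<lambda>n. n + k) ` F" u] that by simp
  qed
  have "norm (laplacian u) \<le> 2 * norm u"
  proof (rule norm_ell2_leI)
    fix F :: "int set" assume F: "finite F"
    have "L2_set (\<lambda>n. cmod (ell2_nth (laplacian u) n)) F
        \<le> L2_set (\<lambda>n. cmod (ell2_nth u (n + 1)) + cmod (ell2_nth u (n + - 1))) F"
      by (intro L2_set_mono) (auto simp: norm_triangle_ineq)
    also have "\<dots> \<le> L2_set (\<lambda>n. cmod (ell2_nth u (n + 1))) F + L2_set (\<lambda>n. cmod (ell2_nth u (n + - 1))) F"
      by (rule L2_set_triangle_ineq)
    finally show "L2_set (\<lambda>n. cmod (ell2_nth (laplacian u) n)) F \<le> 2 * norm u"
      using shift[OF F, of 1] shift[OF F, of "- 1"] by linarith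
  qed
  moreover have "norm (mult_op V u) \<le> norm V * norm u"
  proof (rule norm_ell2_leI)
    fix F :: "int set" assume F: "finite F"
    have "L2_set (\<lambda>n. cmod (ell2_nth (mult_op V u) n)) F
        \<le> L2_set (\<lambda>n. norm V * cmod (ell2_nth u n)) F"
      using norm_bounded[of V] by (intro L2_set_mono) (auto simp: norm_mult intro!: mult_right_mono)
    also have "\<dots> = norm V * L2_set (\<lambda>n. cmod (ell2_nth u n)) F"
      by (simp add: L2_set_right_distrib)
    also have "\<dots> \<le> norm V * norm u"
      by (intro mult_left_mono L2_set_le_norm_ell2 F) simp
    finally show "L2_set (\<lambda>n. cmod (ell2_nth (mult_op V u) n)) F \<le> norm V * norm u" .
  qed
  ultimately show ?thesis unfolding schroedinger_def
    using norm_triangle_ineq[of "laplacian u" "mult_op V u"] by (simp add: algebra_simps)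
qed

lemma evolution_sums:
  "(\<lambda>k. ((\<lambda>u. (- \<i> * complex_of_real t) *\<^sub>C schroedinger V u) ^^ k) \<psi> /\<^sub>R fact k) sums evolution V t \<psi>"
  unfolding evolution_def op_exp_def
proof (intro summable_sums summable_op_exp)
  show "norm ((- \<i> * complex_of_real t) *\<^sub>C schroedinger V u) \<le> (\<bar>t\<bar> * (2 + norm V)) * norm u" for u
    using mult_left_mono[OF norm_schroedinger_le[of V u], of "\<bar>t\<bar>"]
    by (simp add: norm_scaleC_ell2 norm_mult mult.assoc)
qed auto

lemma exp_decaying_evolution:
  assumes "exp_decaying \<psi>" shows "exp_decaying (evolution V t \<psi>)"
proof -
  obtain K c where K: "K > 0" and c: "c > 0"
    and dec: "\<And>n. cmod (ell2_nth \<psi> n) \<le> K * exp (- c * \<bar>real_of_int n\<bar>)"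
    using assms unfolding exp_decaying_def by blast
  define A where "A = (\<lambda>u. (- \<i> * complex_of_real t) *\<^sub>C schroedinger V u)"
  define C where "C = \<bar>t\<bar> * (2 * exp c + norm V)"
  have le: "cmod (ell2_nth ((A ^^ k) \<psi>) n) \<le> C ^ k * K * exp (- c * \<bar>real_of_int n\<bar>)" for k n
  proof (induction k arbitrary: n)
    case (Suc k)
    let ?u = "(A ^^ k) \<psi>" and ?e = "\<lambda>n::int. exp (- c * \<bar>real_of_int n\<bar>)"
    have C: "0 \<le> C ^ k * K" using K by (auto simp: C_def intro!: mult_nonneg_nonneg zero_le_power add_nonneg_nonneg)
    have nb: "cmod (ell2_nth ?u m) \<le> C ^ k * K * (exp c * ?e n)" if "\<bar>n - m\<bar> \<le> 1" for m
    proof -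
      have "\<bar>real_of_int n\<bar> \<le> \<bar>real_of_int m\<bar> + 1" using that by linarith
      hence "c * \<bar>real_of_int n\<bar> \<le> c * (\<bar>real_of_int m\<bar> + 1)" using c by (intro mult_left_mono) auto
      hence "?e m \<le> exp c * ?e n" by (simp add: exp_add[symmetric] algebra_simps)
      thus ?thesis using Suc[of m] C mult_left_mono order_trans by blast
    qed
    have V: "\<bar>apply_bcontfun V n\<bar> * cmod (ell2_nth ?u n) \<le> norm V * (C ^ k * K * ?e n)"
      using norm_bounded[of V n] Suc[of n] by (intro mult_mono) auto
    have "cmod (ell2_nth (schroedinger V ?u) n)
        \<le> cmod (ell2_nth ?u (n + 1)) + cmod (ell2_nth ?u (n - 1))
          + \<bar>apply_bcontfun V n\<bar> * cmod (ell2_nth ?u n)"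
      unfolding schroedinger_def
      by (simp, intro norm_triangle_le add_mono norm_triangle_ineq) (simp add: norm_mult)
    also have "\<dots> \<le> (2 * exp c + norm V) * (C ^ k * K * ?e n)"
      using nb[of "n + 1"] nb[of "n - 1"] V by (simp add: algebra_simps)
    finally have "\<bar>t\<bar> * cmod (ell2_nth (schroedinger V ?u) n)
        \<le> \<bar>t\<bar> * ((2 * exp c + norm V) * (C ^ k * K * ?e n))"
      by (rule mult_left_mono) simp
    thus ?case by (simp add: A_def norm_mult C_def mult.assoc)
  qed (use dec in simp)
  have "cmod (ell2_nth (evolution V t \<psi>) n) \<le> (exp C * K) * exp (- c * \<bar>real_of_int n\<bar>)" for n
  proof -
    have S: "(\<lambda>k. ell2_nth ((A ^^ k) \<psi> /\<^sub>R fact k) n) sums ell2_nth (evolution V t \<psi>) n"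
      using bounded_linear.sums[OF bounded_linear_ell2_nth evolution_sums] unfolding A_def .
    have E: "(\<lambda>k. C ^ k /\<^sub>R fact k * (K * exp (- c * \<bar>real_of_int n\<bar>)))
        sums (exp C * (K * exp (- c * \<bar>real_of_int n\<bar>)))"
      by (intro sums_mult2 exp_converges)
    have "norm (suminf (\<lambda>k. ell2_nth ((A ^^ k) \<psi> /\<^sub>R fact k) n))
        \<le> (\<Sum>k. C ^ k /\<^sub>R fact k * (K * exp (- c * \<bar>real_of_int n\<bar>)))"
    proof (rule norm_suminf_le)
      show "norm (ell2_nth ((A ^^ k) \<psi> /\<^sub>R fact k) n)
          \<le> C ^ k /\<^sub>R fact k * (K * exp (- c * \<bar>real_of_int n\<bar>))" for k
        using mult_left_mono[OF le[of k n], of "inverse (fact k)"]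
        by (simp add: norm_mult norm_inverse mult.assoc)
    qed (use E in \<open>simp add: sums_iff\<close>)
    thus ?thesis using S E by (simp add: sums_iff mult.assoc)
  qed
  thus ?thesis unfolding exp_decaying_def using K c by (intro exI[of _ "exp C * K"] exI[of _ c]) auto
qed

lemma summable_on_exp_decay:
  assumes "c > 0" shows "(\<lambda>n::int. exp (- c * \<bar>real_of_int n\<bar>)) summable_on UNIV"
proof -
  let ?f = "\<lambda>n::int. exp (- c * \<bar>real_of_int n\<bar>)"
  have "summable (\<lambda>k::nat. exp (- c) ^ k)" using assms by (intro summable_geometric) simp
  hence nat: "(\<lambda>k::nat. exp (- c * real k)) summable_on UNIV"
    by (intro summable_nonneg_imp_summable_on) (simp_all add: exp_of_nat_mult[symmetric] mult.commute)
  have "?f summable_on range int"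
    using nat by (subst summable_on_reindex) (auto simp: o_def)
  moreover have "?f summable_on range (\<lambda>k. - int k)"
    using nat by (subst summable_on_reindex) (auto simp: o_def inj_on_def)
  ultimately have "?f summable_on (range int \<union> range (\<lambda>k. - int k))" by (rule summable_on_union)
  moreover have "range int \<union> range (\<lambda>k. - int k) = UNIV"
    by (auto simp: image_iff) (metis int_cases2)
  ultimately show ?thesis by simp
qed

lemma powr_le_exp:
  fixes x :: real
  assumes "x \<ge> 0" "p > 0" "c > 0"
  shows "x powr p \<le> (p / c) powr p * exp (c * x)"
proof (cases "x = 0")
  case False
  hence y: "c * x / p > 0" using assms by simp
  have "(c * x / p) powr p = exp (p * ln (c * x / p))" using y by (auto simp: powr_def)
  also have "p * ln (c * x / p) \<le> p * (c * x / p)"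
    using ln_le_minus_one[OF y] assms by (intro mult_left_mono) auto
  also have "p * (c * x / p) = c * x" using assms by simp
  finally have "(p / c) powr p * (c * x / p) powr p \<le> (p / c) powr p * exp (c * x)"
    by (intro mult_left_mono) auto
  moreover have "(p / c) powr p * (c * x / p) powr p = x powr p"
    using assms by (subst powr_mult[symmetric]) auto
  ultimately show ?thesis by simp
qed simp

lemma moment_evolution:
  fixes V t
  assumes "exp_decaying \<psi>" "p > 0"
  defines "\<phi> \<equiv> ell2_nth (evolution V t \<psi>)"
  shows "((\<lambda>n. cnj (\<phi> n) * position_power p \<phi> n) has_sum
           complex_of_real (moment p (evolution V t \<psi>))) UNIV"
    and "((\<lambda>n. \<bar>real_of_int n\<bar> powr p * (cmod (\<phi> n))\<^sup>2) has_sum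
           moment p (evolution V t \<psi>)) UNIV"
proof -
  let ?g = "\<lambda>n. \<bar>real_of_int n\<bar> powr p * (cmod (\<phi> n))\<^sup>2"
  obtain K c where K: "K > 0" and c: "c > 0"
    and dec: "\<And>n. cmod (\<phi> n) \<le> K * exp (- c * \<bar>real_of_int n\<bar>)"
    using exp_decaying_evolution[OF assms(1)] unfolding exp_decaying_def \<phi>_def by blast
  have "?g summable_on UNIV"
  proof (rule summable_on_comparison_test)
    show "(\<lambda>n::int. (p / c) powr p * K\<^sup>2 * exp (- c * \<bar>real_of_int n\<bar>)) summable_on UNIV"
      by (intro summable_on_cmult_right summable_on_exp_decay c)
    fix n :: int
    let ?x = "\<bar>real_of_int n\<bar>"
    have "?g n \<le> ((p / c) powr p * exp (c * ?x)) * (K * exp (- c * ?x))\<^sup>2"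
      using dec[of n] by (intro mult_mono powr_le_exp power_mono assms c) auto
    also have "\<dots> = (p / c) powr p * K\<^sup>2 * (exp (c * ?x) * exp (- c * ?x) * exp (- c * ?x))"
      by (simp add: power2_eq_square)
    also have "\<dots> = (p / c) powr p * K\<^sup>2 * exp (- c * ?x)"
      by (simp add: exp_add[symmetric])
    finally show "?g n \<le> (p / c) powr p * K\<^sup>2 * exp (- c * ?x)" .
  qed auto
  then obtain S where S: "(?g has_sum S) UNIV" by (auto simp: summable_on_def)
  have *: "cnj (\<phi> n) * position_power p \<phi> n = complex_of_real (?g n)" for n
    unfolding position_power_def of_real_mult complex_norm_square by (simp add: mult_ac)
  have "((\<lambda>n. cnj (\<phi> n) * position_power p \<phi> n) has_sum complex_of_real S) UNIV"
    unfolding * by (rule has_sum_of_real[OF S])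
  moreover from this have "moment p (evolution V t \<psi>) = S"
    unfolding moment_def seq_inner_def \<phi>_def[symmetric] by (simp add: infsumI)
  ultimately show "((\<lambda>n. cnj (\<phi> n) * position_power p \<phi> n) has_sum
           complex_of_real (moment p (evolution V t \<psi>))) UNIV"
    and "(?g has_sum moment p (evolution V t \<psi>)) UNIV" using S by simp_all
qed

end

theory Submission
  imports Defs "HOL-Real_Asymp.Real_Asymp"
begin


text \<open>For a periodic potential of period \<open>q\<close> the operator \<open>A u = u(\<cdot> + q) + u(\<cdot> - q)\<close> commutes with
  \<open>H\<close>, and is therefore a polynomial in \<open>H\<close>, say \<open>A = \<Sum> c\<^sub>k H\<^sup>k\<close>. With \<open>X\<close> the position operator, the
  local operator \<open>Y = \<Sum> c\<^sub>k \<Sum> H\<^sup>i X H\<^sup>j\<close> (inner sum over \<open>i + j = k - 1\<close>) satisfies \<open>[H, Y] = [A, X] = q D\<close>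
  with \<open>D u = u(\<cdot> + q) - u(\<cdot> - q)\<close>, which commutes with \<open>H\<close>. Hence \<open>Y \<psi>(t)\<close> is the evolution of
  \<open>Y \<psi> + \<i> t q D \<psi>\<close>, and as \<open>Y\<close> is bounded by \<open>1 + \<bar>X\<bar>\<close>, the norm of \<open>(1 + \<bar>X\<bar>) \<psi>(t)\<close> grows linearly
  whenever \<open>D \<psi> \<noteq> 0\<close>, which is the case for every nonzero \<open>\<psi>\<close>.

  Up to a factor \<open>ln T\<close>, such a lower bound at a single time \<open>T\<close>, uniformly over a class of
  exponentially decaying states, is an open condition on the potential. It holds on the dense set of
  periodic potentials, so Baire's theorem gives it generically for arbitrarily large \<open>T\<close>. The upper bound,
  and the transfer from the second moment to all moments, use that \<open>\<psi>(t)\<close> is exponentially small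
  outside a light cone.\<close>

subsection \<open>Band matrices commuting with the Schroedinger matrix\<close>

text \<open>\<open>lmul V a\<close> and \<open>rmul V a\<close> are the matrix products
  \<open>H a\<close> and \<open>a H\<close>, where \<open>H\<close> has ones next to the diagonal
  and \<open>V\<close> on it. Working with entries instead of operators admits unbounded matrices
  such as \<open>Y\<close>.\<close>

definition lmul :: "(int \<Rightarrow> real) \<Rightarrow> (int \<Rightarrow> int \<Rightarrow> real) \<Rightarrow> int \<Rightarrow> int \<Rightarrow> real" where
  "lmul V a m n = a (m + 1) n + a (m - 1) n + V m * a m n"

definition rmul :: "(int \<Rightarrow> real) \<Rightarrow> (int \<Rightarrow> int \<Rightarrow> real) \<Rightarrow> int \<Rightarrow> int \<Rightarrow> real" where
  "rmul V a m n = a m (n + 1) + a m (n - 1) + V n * a m n"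

definition band :: "nat \<Rightarrow> (int \<Rightarrow> int \<Rightarrow> real) \<Rightarrow> bool" where
  "band r a \<longleftrightarrow> (\<forall>m n. \<bar>m - n\<bar> > int r \<longrightarrow> a m n = 0)"

definition hpow :: "(int \<Rightarrow> real) \<Rightarrow> nat \<Rightarrow> int \<Rightarrow> int \<Rightarrow> real" where
  "hpow V k = (lmul V ^^ k) (\<lambda>m n. if m = n then 1 else 0)"

lemma hpow_0: "hpow V 0 m n = (if m = n then 1 else 0)"
  by (simp add: hpow_def)

lemma hpow_Suc: "hpow V (Suc k) = lmul V (hpow V k)"
  by (simp add: hpow_def)

text \<open>This is associativity, \<open>H (a H) = (H a) H\<close>.\<close>

lemma lmul_rmul_commute: "lmul V (rmul V a) = rmul V (lmul V a)"
  by (intro ext) (simp add: lmul_def rmul_def algebra_simps)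

lemma rmul_hpow: "rmul V (hpow V k) = hpow V (Suc k)"
proof (induction k)
  case 0
  show ?case by (intro ext) (simp add: hpow_Suc hpow_0 lmul_def rmul_def)
next
  case (Suc k)
  thus ?case by (simp add: hpow_Suc lmul_rmul_commute[symmetric])
qed

text \<open>Transposition exchanges \<open>lmul\<close> and \<open>rmul\<close>, and these agree on
  powers of \<open>H\<close>.\<close>

lemma hpow_sym: "hpow V k m n = hpow V k n m"
proof (induction k arbitrary: m n)
  case (Suc k)
  have "hpow V (Suc k) m n = lmul V (hpow V k) m n" by (simp add: hpow_Suc)
  also have "\<dots> = rmul V (hpow V k) n m"
    using Suc by (simp add: lmul_def rmul_def)
  finally show ?case by (simp add: rmul_hpow)
qed (simp add: hpow_0)

lemma band_lmul: "band r a \<Longrightarrow> band (Suc r) (lmul V a)"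
  by (auto simp: band_def lmul_def)

lemma band_rmul: "band r a \<Longrightarrow> band (Suc r) (rmul V a)"
  by (auto simp: band_def rmul_def)

lemma band_hpow: "band k (hpow V k)"
proof (induction k)
  case 0 show ?case by (auto simp: band_def hpow_0)
qed (simp add: hpow_Suc band_lmul)

text \<open>Only one path of \<open>k\<close> nearest-neighbour steps leads from \<open>m\<close> to
  \<open>m + k\<close>, and each of its steps has weight 1.\<close>

lemma hpow_top: "hpow V k m (m + int k) = 1"
proof (induction k arbitrary: m)
  case (Suc k)
  have "hpow V k (m - 1) (m + int (Suc k)) = 0" "hpow V k m (m + int (Suc k)) = 0"
    using band_hpow[of k V] by (auto simp: band_def)
  with Suc[of "m + 1"] show ?case by (simp add: hpow_Suc lmul_def algebra_simps)
qed (simp add: hpow_0)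

lemma hpow_bound:
  assumes "\<And>n. \<bar>V n\<bar> \<le> B"
  shows "\<bar>hpow V k m n\<bar> \<le> (2 + B) ^ k"
proof (induction k arbitrary: m)
  case (Suc k)
  have B: "B \<ge> 0" using assms[of 0] by linarith
  have "\<bar>V m\<bar> * \<bar>hpow V k m n\<bar> \<le> B * (2 + B) ^ k"
    using assms Suc B by (intro mult_mono) auto
  hence "\<bar>hpow V (Suc k) m n\<bar> \<le> (2 + B) ^ k + (2 + B) ^ k + B * (2 + B) ^ k"
    unfolding hpow_Suc lmul_def using Suc[of "m + 1"] Suc[of "m - 1"]
    by (intro abs_triangle_ineq[THEN order_trans] add_mono) (auto simp: abs_mult)
  thus ?case by (simp add: algebra_simps)
qed (simp add: hpow_0)

text \<open>\<open>(n - m) * a m n\<close> are the entries of the commutator of \<open>a\<close> with the position operator.\<close>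

definition conjugate_to :: "(int \<Rightarrow> real) \<Rightarrow> (int \<Rightarrow> int \<Rightarrow> real) \<Rightarrow> (int \<Rightarrow> int \<Rightarrow> real) \<Rightarrow> bool" where
  "conjugate_to V a y \<longleftrightarrow> (\<exists>r. band r y) \<and> (\<exists>C. \<forall>m n. \<bar>y m n\<bar> \<le> C * (1 + \<bar>real_of_int n\<bar>)) \<and>
     (\<forall>m n. lmul V y m n - rmul V y m n = real_of_int (n - m) * a m n)"

lemma conjugate_to_lincomb:
  assumes "conjugate_to V a y" "conjugate_to V b z"
  shows "conjugate_to V (\<lambda>m n. a m n + c * b m n) (\<lambda>m n. y m n + c * z m n)"
proof -
  obtain r s C E where *: "band r y" "band s z"
    and C: "\<And>m n. \<bar>y m n\<bar> \<le> C * (1 + \<bar>real_of_int n\<bar>)"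
    and E: "\<And>m n. \<bar>z m n\<bar> \<le> E * (1 + \<bar>real_of_int n\<bar>)"
    and L: "\<And>m n. lmul V y m n - rmul V y m n = real_of_int (n - m) * a m n"
           "\<And>m n. lmul V z m n - rmul V z m n = real_of_int (n - m) * b m n"
    using assms unfolding conjugate_to_def by metis
  have "band (max r s) (\<lambda>m n. y m n + c * z m n)" using * by (auto simp: band_def)
  moreover have "\<bar>y m n + c * z m n\<bar> \<le> (C + \<bar>c\<bar> * E) * (1 + \<bar>real_of_int n\<bar>)" for m n
    using C[of m n] mult_left_mono[OF E[of m n], of "\<bar>c\<bar>"]
      abs_triangle_ineq[of "y m n" "c * z m n"] by (simp add: abs_mult algebra_simps)
  moreover have "lmul V (\<lambda>m n. y m n + c * z m n) m n - rmul V (\<lambda>m n. y m n + c * z m n) m n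
      = real_of_int (n - m) * (a m n + c * b m n)" for m n
  proof -
    have "lmul V (\<lambda>m n. y m n + c * z m n) m n - rmul V (\<lambda>m n. y m n + c * z m n) m n
      = (lmul V y m n - rmul V y m n) + c * (lmul V z m n - rmul V z m n)"
      by (simp add: lmul_def rmul_def algebra_simps)
    thus ?thesis by (simp add: L algebra_simps)
  qed
  ultimately show ?thesis unfolding conjugate_to_def by blast
qed

text \<open>The induction takes \<open>H y + X H^k\<close> as the next matrix, following
  \<open>[H^(k+1), X] = H [H^k, X] + [H, X] H^k\<close>. The linear bound survives because within
  the band the row index exceeds the column index by at most \<open>k\<close> in absolute
  value.\<close>

lemma conjugate_to_hpow:
  assumes B: "\<And>n. \<bar>V n\<bar> \<le> B"
  shows "\<exists>y. conjugate_to V (hpow V k) y"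
proof (induction k)
  case 0
  have "conjugate_to V (hpow V 0) (\<lambda>m n. 0)"
    unfolding conjugate_to_def by (auto simp: band_def lmul_def rmul_def hpow_0 intro!: exI[of _ 0])
  thus ?case by blast
next
  case (Suc k)
  have B0: "B \<ge> 0" using B[of 0] by linarith
  obtain y r C where y: "band r y" and C: "\<And>m n. \<bar>y m n\<bar> \<le> C * (1 + \<bar>real_of_int n\<bar>)"
    and L: "\<And>m n. lmul V y m n - rmul V y m n = real_of_int (n - m) * hpow V k m n"
    using Suc unfolding conjugate_to_def by metis
  let ?x = "\<lambda>m n. real_of_int m * hpow V k m n"
  let ?z = "\<lambda>m n. lmul V y m n + ?x m n"
  let ?D = "real (Suc k) * (2 + B) ^ k"
  have "band (max (Suc r) k) ?z"
    using band_lmul[OF y, of V] band_hpow[of k V] by (auto simp: band_def)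
  moreover have "\<bar>?z m n\<bar> \<le> ((2 + B) * C + ?D) * (1 + \<bar>real_of_int n\<bar>)" for m n
  proof -
    have "\<bar>V m\<bar> * \<bar>y m n\<bar> \<le> B * (C * (1 + \<bar>real_of_int n\<bar>))"
      using B C B0 by (intro mult_mono) auto
    hence 1: "\<bar>lmul V y m n\<bar> \<le> C * (1 + \<bar>real_of_int n\<bar>) + C * (1 + \<bar>real_of_int n\<bar>) + B * (C * (1 + \<bar>real_of_int n\<bar>))"
      unfolding lmul_def using C
      by (intro abs_triangle_ineq[THEN order_trans] add_mono) (auto simp: abs_mult)
    have 2: "\<bar>?x m n\<bar> \<le> ?D * (1 + \<bar>real_of_int n\<bar>)"
    proof (cases "\<bar>m - n\<bar> > int k")
      case True
      hence "hpow V k m n = 0" using band_hpow[of k V] by (auto simp: band_def)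
      thus ?thesis using B0 by simp
    next
      case False
      hence "\<bar>real_of_int m\<bar> \<le> real k + \<bar>real_of_int n\<bar>" by linarith
      also have "\<dots> \<le> real (Suc k) * (1 + \<bar>real_of_int n\<bar>)" by (simp add: algebra_simps)
      finally have "\<bar>real_of_int m\<bar> * \<bar>hpow V k m n\<bar> \<le> (real (Suc k) * (1 + \<bar>real_of_int n\<bar>)) * (2 + B) ^ k"
        using hpow_bound[OF B] by (intro mult_mono) auto
      thus ?thesis by (simp add: abs_mult mult_ac)
    qed
    have "\<bar>?z m n\<bar> \<le> \<bar>lmul V y m n\<bar> + \<bar>?x m n\<bar>" by (rule abs_triangle_ineq)
    with 1 2 have "\<bar>?z m n\<bar> \<le> C * (1 + \<bar>real_of_int n\<bar>) + C * (1 + \<bar>real_of_int n\<bar>)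
      + B * (C * (1 + \<bar>real_of_int n\<bar>)) + ?D * (1 + \<bar>real_of_int n\<bar>)" by linarith
    also have "\<dots> = ((2 + B) * C + ?D) * (1 + \<bar>real_of_int n\<bar>)" by (simp add: algebra_simps)
    finally show ?thesis .
  qed
  moreover have "lmul V ?z m n - rmul V ?z m n = real_of_int (n - m) * hpow V (Suc k) m n" for m n
  proof -
    have "lmul V ?z m n - rmul V ?z m n
      = (lmul V (lmul V y) m n - rmul V (lmul V y) m n) + (lmul V ?x m n - rmul V ?x m n)"
      by (simp add: lmul_def rmul_def algebra_simps)
    also have "lmul V (lmul V y) m n - rmul V (lmul V y) m n
      = lmul V (\<lambda>m n. lmul V y m n - rmul V y m n) m n"
      unfolding lmul_rmul_commute[symmetric] by (simp add: lmul_def algebra_simps)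
    also have "\<dots> = lmul V (\<lambda>m n. real_of_int (n - m) * hpow V k m n) m n" by (simp add: L)
    also have "rmul V ?x m n = real_of_int m * rmul V (hpow V k) m n"
      by (simp add: rmul_def algebra_simps)
    finally show ?thesis by (simp add: rmul_hpow hpow_Suc) (simp add: lmul_def algebra_simps)
  qed
  ultimately show ?case unfolding conjugate_to_def by blast
qed

text \<open>Commuting with the Schroedinger matrix forces the extreme diagonals to be constant; symmetry
  makes the two constants equal, so a multiple of a power of the Schroedinger matrix removes both.\<close>

lemma conjugate_to_commuting:
  assumes B: "\<And>n. \<bar>V n\<bar> \<le> B" and sym: "\<And>m n. a m n = a n m"
    and com: "lmul V a = rmul V a" and "band r a"
  shows "\<exists>y. conjugate_to V a y"
  using sym com \<open>band r a\<close>
proof (induction r arbitrary: a)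
  case 0
  \<comment> \<open>A diagonal matrix commutes with the position operator, so the zero matrix is
    conjugate to it.\<close>
  hence "real_of_int (n - m) * a m n = 0" for m n by (cases "m = n") (auto simp: band_def)
  hence "conjugate_to V a (\<lambda>m n. 0)"
    unfolding conjugate_to_def by (auto simp: band_def lmul_def rmul_def intro!: exI[of _ 0])
  thus ?case by blast
next
  case (Suc r)
  define \<alpha> where "\<alpha> = a 0 (1 + int r)"
  have zero: "a m n = 0" if "\<bar>m - n\<bar> > int r + 1" for m n
    using that Suc.prems(3) by (auto simp: band_def)
  \<comment> \<open>In the entry \<open>(m, m + r + 2)\<close> of \<open>H a = a H\<close> the band
    condition leaves a single term on each side.\<close>
  have step: "a (m + 1) (m + 1 + 1 + int r) = a m (m + 1 + int r)" for m
    using fun_cong[OF fun_cong[OF Suc.prems(2)], of m "m + 2 + int r"]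
      zero[of "m - 1" "m + 2 + int r"] zero[of m "m + 2 + int r"] zero[of m "m + 3 + int r"]
    by (simp add: lmul_def rmul_def algebra_simps)
  have top: "a m (m + 1 + int r) = \<alpha>" for m
  proof (induction m rule: int_induct[where k = 0])
    case (step1 i) thus ?case using step[of i] by simp
  next
    case (step2 i) thus ?case using step[of "i - 1"] by (simp add: algebra_simps)
  qed (simp add: \<alpha>_def)
  let ?b = "\<lambda>m n. a m n - \<alpha> * hpow V (Suc r) m n"
  have "\<exists>y. conjugate_to V ?b y"
  proof (rule Suc.IH)
    show "?b m n = ?b n m" for m n using Suc.prems(1) hpow_sym by metis
    have "lmul V ?b m n = rmul V ?b m n" for m n
    proof -
      have "lmul V ?b m n = lmul V a m n - \<alpha> * lmul V (hpow V (Suc r)) m n"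
        by (simp add: lmul_def algebra_simps)
      also have "\<dots> = rmul V a m n - \<alpha> * rmul V (hpow V (Suc r)) m n"
        by (simp only: Suc.prems(2) rmul_hpow hpow_Suc[symmetric])
      also have "\<dots> = rmul V ?b m n" by (simp add: rmul_def algebra_simps)
      finally show ?thesis .
    qed
    thus "lmul V ?b = rmul V ?b" by blast
    show "band r ?b" unfolding band_def
    proof (intro allI impI)
      fix m n :: int assume "\<bar>m - n\<bar> > int r"
      then consider "\<bar>m - n\<bar> > int (Suc r)" | "n = m + 1 + int r" | "m = n + 1 + int r" by linarith
      thus "?b m n = 0"
      proof cases
        case 1 thus ?thesis using zero[of m n] band_hpow[of "Suc r" V] by (auto simp: band_def)
      next
        case 2 thus ?thesis using top[of m] hpow_top[of V "Suc r" m] by (simp add: algebra_simps)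
      next
        case 3 thus ?thesis
          using top[of n] hpow_top[of V "Suc r" n] Suc.prems(1)[of m n] hpow_sym[of V "Suc r" m n]
          by (simp add: algebra_simps)
      qed
    qed
  qed
  then obtain y where "conjugate_to V ?b y" by blast
  moreover obtain z where "conjugate_to V (hpow V (Suc r)) z" using conjugate_to_hpow[of V B, OF B] by blast
  ultimately have "conjugate_to V (\<lambda>m n. ?b m n + \<alpha> * hpow V (Suc r) m n) (\<lambda>m n. y m n + \<alpha> * z m n)"
    by (rule conjugate_to_lincomb)
  thus ?case by auto
qed


subsection \<open>Unitarity of the time evolution\<close>

lemma summable_on_inner_ell2:
  "(\<lambda>n. inner (ell2_nth u n) (ell2_nth v n)) summable_on UNIV"
proof (rule abs_summable_summable)
  show "(\<lambda>n. norm (inner (ell2_nth u n) (ell2_nth v n))) summable_on UNIV"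
  proof (rule summable_on_comparison_test)
    show "(\<lambda>n. (cmod (ell2_nth u n))\<^sup>2 + (cmod (ell2_nth v n))\<^sup>2) summable_on UNIV"
      by (intro summable_on_add ell2_summable)
    fix n
    have "norm (inner (ell2_nth u n) (ell2_nth v n)) \<le> cmod (ell2_nth u n) * cmod (ell2_nth v n)"
      unfolding real_norm_def by (rule Cauchy_Schwarz_ineq2)
    also have "\<dots> \<le> (cmod (ell2_nth u n))\<^sup>2 + (cmod (ell2_nth v n))\<^sup>2"
      using sum_squares_bound[of "cmod (ell2_nth u n)" "cmod (ell2_nth v n)"]
        mult_nonneg_nonneg[OF norm_ge_zero norm_ge_zero, of "ell2_nth u n" "ell2_nth v n"] by linarith
    finally show "norm (inner (ell2_nth u n) (ell2_nth v n))
        \<le> (cmod (ell2_nth u n))\<^sup>2 + (cmod (ell2_nth v n))\<^sup>2" .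
  qed auto
qed

instantiation ell2 :: real_inner
begin
text \<open>The real part of the complex inner product. It already determines the norm, which is all
  that unitarity is about here.\<close>

definition inner_ell2 :: "ell2 \<Rightarrow> ell2 \<Rightarrow> real" where
  "inner_ell2 u v = (\<Sum>\<^sub>\<infinity>n. inner (ell2_nth u n) (ell2_nth v n))"
instance
proof
  fix u v w :: ell2 and r :: real
  show "inner u v = inner v u" by (simp add: inner_ell2_def inner_commute)
  show "inner (u + v) w = inner u w + inner v w"
    by (simp add: inner_ell2_def inner_add_left infsum_add summable_on_inner_ell2)
  show "inner (r *\<^sub>R u) v = r * inner u v"
    by (simp add: inner_ell2_def scaleR_conv_of_real[symmetric] infsum_cmult_right')
  show n: "norm u = sqrt (inner u u)"
    by (simp add: inner_ell2_def norm_ell2_def power2_norm_eq_inner)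
  show "0 \<le> inner u u" by (auto simp: inner_ell2_def intro!: infsum_nonneg)
  thus "inner u u = 0 \<longleftrightarrow> u = 0"
    using n norm_eq_zero[of u] by (metis real_sqrt_eq_zero_cancel real_sqrt_zero)
qed
end

lemma infsum_telescope_int:
  fixes g :: "int \<Rightarrow> real"
  assumes "g summable_on UNIV"
  shows "(\<Sum>\<^sub>\<infinity>n. g n - g (n - 1)) = 0"
proof -
  have bij: "bij_betw (\<lambda>n::int. n - 1) UNIV UNIV"
    by (rule bij_betwI[where g = "\<lambda>n. n + 1"]) auto
  obtain S where S: "(g has_sum S) UNIV" using assms by (auto simp: summable_on_def)
  hence "((\<lambda>n. g (n - 1)) has_sum S) UNIV" using has_sum_reindex_bij_betw[OF bij, of g] by simp
  hence "((\<lambda>n. - g (n - 1)) has_sum - S) UNIV" by (rule has_sum_uminusI)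
  from has_sum_add[OF S this] show ?thesis by (intro infsumI) simp
qed

text \<open>The potential contributes the real part of an imaginary number, which is 0. The two
  hopping terms are the outgoing and incoming currents at \<open>n\<close>, so the sum over all
  sites telescopes.\<close>

lemma inner_imaginary_schroedinger:
  "inner u ((- \<i> * complex_of_real t) *\<^sub>C schroedinger V u) = 0"
proof -
  let ?c = "- \<i> * complex_of_real t"
  let ?g = "\<lambda>n. inner (ell2_nth u n) (?c * ell2_nth u (n + 1))"
  have eq: "inner (ell2_nth u n) (ell2_nth (?c *\<^sub>C schroedinger V u) n) = ?g n - ?g (n - 1)" for n
    by (simp add: schroedinger_def inner_complex_def algebra_simps)
  have "(\<lambda>n. (cmod (ell2_nth u (n + 1)))\<^sup>2) summable_on UNIV"
    by (intro sq_summable_shift ell2_summable)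
  then obtain v where v: "ell2_nth v = (\<lambda>n. ell2_nth u (n + 1))"
    using Abs_ell2_inverse[of "\<lambda>n. ell2_nth u (n + 1)"] by simp
  have g: "?g summable_on UNIV"
    using summable_on_inner_ell2[of u "?c *\<^sub>C v"] by (simp add: v)
  show ?thesis unfolding inner_ell2_def eq by (rule infsum_telescope_int[OF g])
qed

text \<open>The derivative of \<open>\<parallel>E\<^sub>N(s) u\<parallel>\<^sup>2\<close> for the partial sums of the exponential series is
  \<open>2 \<langle>E\<^sub>N u - E\<^sub>N\<^sub>-\<^sub>1 u, A E\<^sub>N\<^sub>-\<^sub>1 u\<rangle>\<close> by skewness, hence is bounded by a term of the series.\<close>

lemma norm_op_exp_skew:
  fixes A :: "ell2 \<Rightarrow> ell2"
  assumes A: "bounded_linear A" and skew: "\<And>u. inner u (A u) = 0"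
  shows "norm (op_exp A u) = norm u"
proof -
  interpret A: bounded_linear A by fact
  obtain B where B: "B > 0" and bnd: "\<And>u. norm (A u) \<le> norm u * B"
    using A.pos_bounded by blast
  define x where "x k = (A ^^ k) u /\<^sub>R fact k" for k
  \<comment> \<open>The partial sums of the series for \<open>exp (s A) u\<close>. As
    \<open>s\<close> runs from 0 to 1, nonempty partial sums move from \<open>u\<close> to those of
    \<open>op_exp A u\<close>, so the mean value theorem can compare the norms.\<close>
  define E where "E N s = (\<Sum>k<N. s ^ k *\<^sub>R x k)" for N and s :: real
  define a where "a k = B ^ k /\<^sub>R fact k" for k
  have a0: "a k \<ge> 0" for k using B by (simp add: a_def)
  have a_sums: "a sums exp B" unfolding a_def by (rule exp_converges)
  have pow: "norm ((A ^^ k) u) \<le> B ^ k * norm u" for k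
  proof (induction k)
    case (Suc k)
    have "norm ((A ^^ Suc k) u) \<le> norm ((A ^^ k) u) * B" using bnd by simp
    also have "\<dots> \<le> (B ^ k * norm u) * B" using Suc B by (intro mult_right_mono) auto
    finally show ?case by (simp add: mult_ac)
  qed simp
  have x: "norm (x k) \<le> a k * norm u" for k
    using mult_left_mono[OF pow[of k], of "inverse (fact k)"] by (simp add: x_def a_def mult_ac)
  have E_le: "norm (E N s) \<le> exp B * norm u" if "0 \<le> s" "s \<le> 1" for N s
  proof -
    have "norm (E N s) \<le> (\<Sum>k<N. a k * norm u)" unfolding E_def
    proof (rule sum_norm_le)
      fix k
      have "s ^ k * norm (x k) \<le> 1 * (a k * norm u)"
        using that x by (intro mult_mono power_le_one) auto
      thus "norm (s ^ k *\<^sub>R x k) \<le> a k * norm u" using that by simp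
    qed
    also have "\<dots> = sum a {..<N} * norm u" by (simp add: sum_distrib_right)
    also have "sum a {..<N} \<le> exp B"
      using sum_le_suminf[OF sums_summable[OF a_sums], of "{..<N}"] a0 a_sums by (auto simp: sums_iff)
    finally show ?thesis by (simp add: mult_right_mono)
  qed
  have deriv: "(E (Suc N) has_vector_derivative A (E N s)) (at s)" for N s
  proof -
    have "((\<lambda>s. \<Sum>k<Suc N. s ^ k *\<^sub>R x k) has_vector_derivative
      (\<Sum>k<Suc N. (real k * s ^ (k - 1)) *\<^sub>R x k)) (at s)"
      by (auto intro!: derivative_eq_intros simp: has_real_derivative_iff_has_vector_derivative[symmetric])
    also have "(\<Sum>k<Suc N. (real k * s ^ (k - 1)) *\<^sub>R x k) = (\<Sum>k<N. (real (Suc k) * s ^ k) *\<^sub>R x (Suc k))"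
      by (subst sum.lessThan_Suc_shift) simp
    also have "\<dots> = A (E N s)"
    proof -
      have "real (Suc k) *\<^sub>R x (Suc k) = A (x k)" for k
      proof -
        have "real (Suc k) * inverse (fact (Suc k)) = inverse (fact k :: real)"
          unfolding fact_Suc by (simp only: inverse_mult_distrib of_nat_mult) (simp del: of_nat_Suc)
        hence "real (Suc k) *\<^sub>R (y /\<^sub>R fact (Suc k)) = y /\<^sub>R fact k" for y :: ell2
          by (simp only: scaleR_scaleR)
        thus ?thesis by (simp only: x_def A.scaleR funpow.simps comp_apply)
      qed
      hence "(real (Suc k) * s ^ k) *\<^sub>R x (Suc k) = s ^ k *\<^sub>R A (x k)" for k
        by (metis mult.commute scaleR_scaleR)
      thus ?thesis by (simp add: E_def A.sum A.scaleR)
    qed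
    finally show ?thesis unfolding E_def .
  qed
  have diff: "\<bar>(norm (E (Suc (Suc N)) 1))\<^sup>2 - (norm u)\<^sup>2\<bar> \<le> a (Suc N) * (2 * B * exp B * (norm u)\<^sup>2)" for N
  proof -
    let ?f = "\<lambda>s. inner (E (Suc (Suc N)) s) (E (Suc (Suc N)) s)"
    let ?f' = "\<lambda>s. 2 * inner (E (Suc (Suc N)) s) (A (E (Suc N) s))"
    have "(?f has_real_derivative ?f' s) (at s)" for s
    proof -
      have "(?f has_derivative (\<lambda>h. inner (E (Suc (Suc N)) s) (h *\<^sub>R A (E (Suc N) s))
          + inner (h *\<^sub>R A (E (Suc N) s)) (E (Suc (Suc N)) s))) (at s)"
        using deriv[of "Suc N" s] unfolding has_vector_derivative_def by (intro has_derivative_inner)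
      thus ?thesis unfolding has_field_derivative_def
        by (rule has_derivative_eq_rhs) (auto simp: inner_commute algebra_simps)
    qed
    then obtain s where s: "0 < s" "s < 1" and mvt: "?f 1 - ?f 0 = (1 - 0) * ?f' s"
      using MVT2[of 0 1 ?f ?f'] by auto
    have "E (Suc (Suc N)) s = E (Suc N) s + s ^ Suc N *\<^sub>R x (Suc N)" by (simp add: E_def)
    hence "?f' s = 2 * (s ^ Suc N * inner (x (Suc N)) (A (E (Suc N) s)))"
      by (simp add: inner_add_left skew)
    hence "\<bar>?f' s\<bar> = 2 * (s ^ Suc N * \<bar>inner (x (Suc N)) (A (E (Suc N) s))\<bar>)"
      using s by (simp add: abs_mult)
    also have "\<dots> \<le> 2 * (1 * \<bar>inner (x (Suc N)) (A (E (Suc N) s))\<bar>)"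
      using s by (intro mult_left_mono mult_right_mono power_le_one) auto
    also have "\<dots> \<le> 2 * (norm (x (Suc N)) * norm (A (E (Suc N) s)))"
      using Cauchy_Schwarz_ineq2[of "x (Suc N)" "A (E (Suc N) s)"] by simp
    also have "\<dots> \<le> 2 * ((a (Suc N) * norm u) * ((exp B * norm u) * B))"
    proof (intro mult_left_mono mult_mono x)
      show "norm (A (E (Suc N) s)) \<le> exp B * norm u * B"
        using bnd[of "E (Suc N) s"] mult_right_mono[OF E_le[of s "Suc N"], of B] s B by linarith
    qed (use a0 in auto)
    also have "\<dots> = a (Suc N) * (2 * B * exp B * (norm u)\<^sup>2)" by (simp add: power2_eq_square)
    finally have "\<bar>?f 1 - ?f 0\<bar> \<le> a (Suc N) * (2 * B * exp B * (norm u)\<^sup>2)" using mvt by simp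
    moreover have "E (Suc (Suc N)) 0 = u"
      unfolding E_def by (subst sum.lessThan_Suc_shift) (simp add: x_def)
    ultimately show ?thesis by (simp add: power2_norm_eq_inner)
  qed
  have "(\<lambda>N. a (Suc N) * (2 * B * exp B * (norm u)\<^sup>2)) \<longlonglongrightarrow> 0"
    using summable_LIMSEQ_zero[OF sums_summable[OF a_sums]]
    by (intro tendsto_mult_left_zero LIMSEQ_Suc)
  hence lim: "(\<lambda>N. (norm (E (Suc (Suc N)) 1))\<^sup>2 - (norm u)\<^sup>2) \<longlonglongrightarrow> 0"
    by (rule Lim_null_comparison[rotated]) (use diff in auto)
  have "summable x" unfolding x_def
    by (rule summable_op_exp[of A B]) (use bnd B in \<open>auto simp: mult.commute\<close>)
  hence "(\<lambda>N. E N 1) \<longlonglongrightarrow> op_exp A u"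
    unfolding E_def op_exp_def x_def[symmetric] using summable_LIMSEQ by fastforce
  hence "(\<lambda>N. E (Suc (Suc N)) 1) \<longlonglongrightarrow> op_exp A u"
    using LIMSEQ_Suc by blast
  hence "(\<lambda>N. (norm (E (Suc (Suc N)) 1))\<^sup>2 - (norm u)\<^sup>2) \<longlonglongrightarrow> (norm (op_exp A u))\<^sup>2 - (norm u)\<^sup>2"
    by (intro tendsto_intros)
  from LIMSEQ_unique[OF this lim] show ?thesis by simp
qed

lemma norm_evolution [simp]: "norm (evolution V t \<psi>) = norm \<psi>"
  unfolding evolution_def
proof (rule norm_op_exp_skew)
  show "bounded_linear (\<lambda>u. (- \<i> * complex_of_real t) *\<^sub>C schroedinger V u)"
  proof (rule bounded_linear_intro)
    show "norm ((- \<i> * complex_of_real t) *\<^sub>C schroedinger V u) \<le> norm u * (\<bar>t\<bar> * (2 + norm V))" for u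
      using mult_left_mono[OF norm_schroedinger_le[of V u], of "\<bar>t\<bar>"]
      by (simp add: norm_scaleC_ell2 norm_mult mult_ac)
  qed (auto intro!: ell2_eqI simp: schroedinger_def algebra_simps)
qed (rule inner_imaginary_schroedinger)

subsection \<open>The evolution in coordinates\<close>

text \<open>Defined on all sequences, because \<open>Y\<close> may map a square-summable sequence to
  one that is not square-summable.\<close>

definition schro_seq :: "(int \<Rightarrow> real) \<Rightarrow> (int \<Rightarrow> complex) \<Rightarrow> int \<Rightarrow> complex" where
  "schro_seq V u n = u (n + 1) + u (n - 1) + complex_of_real (V n) * u n"

lemma ell2_nth_schroedinger: "ell2_nth (schroedinger V u) = schro_seq (apply_bcontfun V) (ell2_nth u)"
  by (auto simp: schroedinger_def schro_seq_def)

lemma schro_seq_diff_mult: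
  "schro_seq V (\<lambda>n. f n - c * g n) = (\<lambda>n. schro_seq V f n - c * schro_seq V g n)"
  by (auto simp: schro_seq_def algebra_simps)

lemma schro_seq_pow_diff_mult:
  "(schro_seq V ^^ k) (\<lambda>n. f n - c * g n) = (\<lambda>n. (schro_seq V ^^ k) f n - c * (schro_seq V ^^ k) g n)"
  by (induction k) (simp_all add: schro_seq_diff_mult)

lemma schro_seq_mult: "schro_seq V (\<lambda>n. c * f n) = (\<lambda>n. c * schro_seq V f n)"
  by (auto simp: schro_seq_def algebra_simps)

lemma ell2_nth_generator_pow:
  "ell2_nth (((\<lambda>u. c *\<^sub>C schroedinger V u) ^^ k) \<psi>)
    = (\<lambda>n. c ^ k * (schro_seq (apply_bcontfun V) ^^ k) (ell2_nth \<psi>) n)"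
proof (induction k)
  case (Suc k)
  have "ell2_nth (((\<lambda>u. c *\<^sub>C schroedinger V u) ^^ Suc k) \<psi>)
    = (\<lambda>n. c * schro_seq (apply_bcontfun V) (ell2_nth (((\<lambda>u. c *\<^sub>C schroedinger V u) ^^ k) \<psi>)) n)"
    by (auto simp: ell2_nth_schroedinger)
  also note Suc
  finally show ?case by (simp add: schro_seq_mult mult.assoc)
qed simp

lemma evolution_nth_sums:
  "(\<lambda>k. (- \<i> * complex_of_real t) ^ k / fact k * (schro_seq (apply_bcontfun V) ^^ k) (ell2_nth \<psi>) n)
    sums ell2_nth (evolution V t \<psi>) n"
proof -
  have "ell2_nth (((\<lambda>u. c *\<^sub>C schroedinger V u) ^^ k) \<psi> /\<^sub>R fact k) n
    = c ^ k / fact k * (schro_seq (apply_bcontfun V) ^^ k) (ell2_nth \<psi>) n" for c k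
    by (simp only: ell2_nth_simps ell2_nth_generator_pow) (simp add: divide_inverse)
  thus ?thesis
    using bounded_linear.sums[OF bounded_linear_ell2_nth[of n] evolution_sums[of t V \<psi>]] by simp
qed

text \<open>For \<open>band r a\<close> this is the full matrix-vector product. The finite window
  makes it meaningful for every sequence and lets it pass through convergent series coordinate by
  coordinate.\<close>

definition band_app :: "nat \<Rightarrow> (int \<Rightarrow> int \<Rightarrow> real) \<Rightarrow> (int \<Rightarrow> complex) \<Rightarrow> int \<Rightarrow> complex" where
  "band_app r a u m = (\<Sum>n = m - int r..m + int r. complex_of_real (a m n) * u n)"

lemma band_app_superset:
  assumes "band r a" "finite F" "{m - int r..m + int r} \<subseteq> F"
  shows "band_app r a u m = (\<Sum>n\<in>F. complex_of_real (a m n) * u n)"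
  unfolding band_app_def
  by (rule sum.mono_neutral_left) (use assms in \<open>auto simp: band_def\<close>)

lemma schro_seq_band_app:
  assumes "band r a"
  shows "schro_seq V (band_app r a u) = band_app (Suc r) (lmul V a) u"
proof
  fix m
  let ?F = "{m - int (Suc r)..m + int (Suc r)}"
  have "band_app r a u k = (\<Sum>n\<in>?F. complex_of_real (a k n) * u n)" if "\<bar>k - m\<bar> \<le> 1" for k
    by (rule band_app_superset[OF assms]) (use that in auto)
  note this[of m] this[of "m - 1"] this[of "m + 1"]
  thus "schro_seq V (band_app r a u) m = band_app (Suc r) (lmul V a) u m"
    by (simp add: schro_seq_def band_app_def lmul_def algebra_simps sum.distrib sum_distrib_left del: of_nat_Suc)
qed

lemma band_app_schro_seq:
  assumes "band r a"
  shows "band_app r a (schro_seq V u) = band_app (Suc r) (rmul V a) u"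
proof
  fix m
  \<comment> \<open>\<open>?G\<close> contains the translates of \<open>?F\<close> by one step in
    either direction, so that all three terms of \<open>schro_seq\<close> can be summed over the
    same window.\<close>
  let ?F = "{m - int (Suc r)..m + int (Suc r)}" and ?G = "{m - int r - 2..m + int r + 2}"
  have zero: "a m n = 0" if "\<bar>m - n\<bar> > int r" for n using assms that by (auto simp: band_def)
  have shift: "(\<Sum>n\<in>?F. complex_of_real (a m n) * u (n + k)) = (\<Sum>n\<in>?G. complex_of_real (a m (n - k)) * u n)"
    if "\<bar>k\<bar> \<le> 1" for k
  proof -
    have "(\<Sum>n\<in>?F. complex_of_real (a m n) * u (n + k))
      = (\<Sum>n\<in>{m - int (Suc r) + k..m + int (Suc r) + k}. complex_of_real (a m (n - k)) * u n)"
      by (rule sum.reindex_bij_witness[of _ "\<lambda>n. n - k" "\<lambda>n. n + k"]) auto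
    also have "\<dots> = (\<Sum>n\<in>?G. complex_of_real (a m (n - k)) * u n)"
      by (rule sum.mono_neutral_left) (use that in \<open>auto intro!: zero\<close>)
    finally show ?thesis .
  qed
  have "band_app r a (schro_seq V u) m = (\<Sum>n\<in>?F. complex_of_real (a m n) * schro_seq V u n)"
    by (rule band_app_superset[OF assms]) auto
  also have "\<dots> = (\<Sum>n\<in>?F. complex_of_real (a m n) * u (n + 1)) + (\<Sum>n\<in>?F. complex_of_real (a m n) * u (n + -1))
     + (\<Sum>n\<in>?F. complex_of_real (a m n) * (complex_of_real (V (n + 0)) * u (n + 0)))"
    by (simp add: schro_seq_def algebra_simps sum.distrib)
  also have "(\<Sum>n\<in>?F. complex_of_real (a m n) * (complex_of_real (V (n + 0)) * u (n + 0)))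
     = (\<Sum>n\<in>?G. complex_of_real (a m n) * (complex_of_real (V n) * u n))"
    unfolding add_0_right by (rule sum.mono_neutral_left) (auto intro!: zero)
  also note shift[of 1, simplified abs_one, OF order_refl]
  also have "(\<Sum>n\<in>?F. complex_of_real (a m n) * u (n + -1)) = (\<Sum>n\<in>?G. complex_of_real (a m (n + 1)) * u n)"
    using shift[of "-1"] by simp
  also have "(\<Sum>n\<in>?G. complex_of_real (a m (n - 1)) * u n) + (\<Sum>n\<in>?G. complex_of_real (a m (n + 1)) * u n)
      + (\<Sum>n\<in>?G. complex_of_real (a m n) * (complex_of_real (V n) * u n))
      = (\<Sum>n\<in>?G. complex_of_real (rmul V a m n) * u n)"
    by (simp add: rmul_def algebra_simps sum.distrib)
  also have "\<dots> = band_app (Suc r) (rmul V a) u m"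
    by (rule band_app_superset[OF band_rmul[OF assms], symmetric]) auto
  finally show "band_app r a (schro_seq V u) m = band_app (Suc r) (rmul V a) u m" .
qed


subsection \<open>Ballistic motion for periodic potentials\<close>

text \<open>A device for constructing elements of \<open>ell2\<close>. The shift \<open>j\<close>
  covers both translates of a state and the single diagonals of a band matrix.\<close>

lemma ell2_dominated:
  assumes C: "C \<ge> 0" and dom: "\<And>n. cmod (f n) \<le> C * cmod (ell2_nth w (n + j))"
  shows "\<exists>v. ell2_nth v = f \<and> norm v \<le> C * norm w"
proof -
  have "(\<lambda>n. C\<^sup>2 * (cmod (ell2_nth w (n + j)))\<^sup>2) summable_on UNIV"
    by (intro summable_on_cmult_right sq_summable_shift ell2_summable)
  moreover have "(cmod (f n))\<^sup>2 \<le> C\<^sup>2 * (cmod (ell2_nth w (n + j)))\<^sup>2" for n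
    using power_mono[OF dom[of n], of 2] by (simp add: power_mult_distrib)
  ultimately have "(\<lambda>n. (cmod (f n))\<^sup>2) summable_on UNIV" by (rule sq_summable_dominated)
  then obtain v where v: "ell2_nth v = f" using Abs_ell2_inverse[of f] by auto
  have "norm v \<le> C * norm w"
  proof (rule norm_ell2_leI)
    fix F :: "int set" assume F: "finite F"
    have "L2_set (\<lambda>n. cmod (ell2_nth v n)) F \<le> L2_set (\<lambda>n. C * cmod (ell2_nth w (n + j))) F"
      by (rule L2_set_mono) (simp_all add: v dom)
    also have "\<dots> = C * L2_set (\<lambda>n. cmod (ell2_nth w (n + j))) F"
      using C by (simp add: L2_set_right_distrib)
    also have "L2_set (\<lambda>n. cmod (ell2_nth w (n + j))) F
      = L2_set (\<lambda>n. cmod (ell2_nth w n)) ((\<lambda>n. n + j) ` F)"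
      unfolding L2_set_def by (subst sum.reindex) (auto simp: inj_on_def)
    also have "\<dots> \<le> norm w" using F by (intro L2_set_le_norm_ell2) simp
    finally show "L2_set (\<lambda>n. cmod (ell2_nth v n)) F \<le> C * norm w" using C by (simp add: mult_left_mono)
  qed
  with v show ?thesis by blast
qed

lemma ell2_nth_sum: "ell2_nth (sum f A) n = (\<Sum>j\<in>A. ell2_nth (f j) n)"
  by (induction A rule: infinite_finite_induct) auto

text \<open>Junk outside the domain of the position operator.\<close>

definition weighted :: "ell2 \<Rightarrow> ell2" where
  "weighted u = Abs_ell2 (\<lambda>n. complex_of_real (1 + \<bar>real_of_int n\<bar>) * ell2_nth u n)"

text \<open>Holds exactly when the weighted sequence is square-summable, that is, when
  \<open>Abs_ell2\<close> in \<open>weighted\<close> returns the intended sequence.\<close>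

definition in_domain :: "ell2 \<Rightarrow> bool" where
  "in_domain u \<longleftrightarrow> (\<forall>n. ell2_nth (weighted u) n = complex_of_real (1 + \<bar>real_of_int n\<bar>) * ell2_nth u n)"

lemma in_domainI:
  assumes "ell2_nth v = (\<lambda>n. complex_of_real (1 + \<bar>real_of_int n\<bar>) * ell2_nth u n)"
  shows "in_domain u" "weighted u = v"
proof -
  show "weighted u = v" unfolding weighted_def assms[symmetric] by (rule ell2_nth_inverse)
  thus "in_domain u" using assms by (simp add: in_domain_def)
qed

lemma norm_weighted_nth:
  "in_domain u \<Longrightarrow> cmod (ell2_nth (weighted u) n) = (1 + \<bar>real_of_int n\<bar>) * cmod (ell2_nth u n)"
  unfolding in_domain_def by (simp only: norm_mult norm_of_real)

text \<open>The matrix is split into its \<open>2 r + 1\<close> diagonals. Each acts as a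
  translation combined with a weight that \<open>C (1 + |X|)\<close> dominates.\<close>

lemma band_app_ell2:
  assumes C: "\<And>m n. \<bar>a m n\<bar> \<le> C * (1 + \<bar>real_of_int n\<bar>)" and u: "in_domain u"
  shows "\<exists>v. ell2_nth v = band_app r a (ell2_nth u) \<and> norm v \<le> (2 * real r + 1) * (C * norm (weighted u))"
proof -
  have C0: "C \<ge> 0" using C[of 0 0] by simp
  let ?f = "\<lambda>j m. complex_of_real (a m (m + j)) * ell2_nth u (m + j)"
  have "\<exists>v. ell2_nth v = ?f j \<and> norm v \<le> C * norm (weighted u)" for j
  proof (rule ell2_dominated[OF C0])
    fix n
    have "cmod (?f j n) \<le> C * (1 + \<bar>real_of_int (n + j)\<bar>) * cmod (ell2_nth u (n + j))"
      unfolding norm_mult norm_of_real by (intro mult_right_mono C) simp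
    thus "cmod (?f j n) \<le> C * cmod (ell2_nth (weighted u) (n + j))"
      by (simp only: norm_weighted_nth[OF u] mult.assoc)
  qed
  then obtain v where v: "\<And>j. ell2_nth (v j) = ?f j" "\<And>j. norm (v j) \<le> C * norm (weighted u)"
    by metis
  let ?s = "sum v {- int r..int r}"
  have "norm ?s \<le> of_nat (card {- int r..int r}) * (C * norm (weighted u))"
    by (rule order_trans[OF norm_sum]) (rule sum_bounded_above[OF v(2)])
  moreover have "real (card {- int r..int r}) = 2 * real r + 1" by simp
  moreover have "ell2_nth ?s m = band_app r a (ell2_nth u) m" for m
    unfolding band_app_def ell2_nth_sum v(1)
    by (rule sum.reindex_bij_witness[of _ "\<lambda>n. n - m" "\<lambda>j. m + j"]) auto
  ultimately show ?thesis by (intro exI[of _ ?s]) auto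
qed

text \<open>For a potential of period \<open>q\<close> the matrix of \<open>u \<mapsto> u(\<cdot> + q) + u(\<cdot> - q)\<close> commutes with the
  Schroedinger matrix.\<close>

lemma periodic_conjugate_operator:
  assumes q: "q > 0" and per: "\<And>n. V (n + q) = V n" and B: "\<And>n. \<bar>V n\<bar> \<le> B"
  obtains r y C where "\<And>m n. \<bar>y m n\<bar> \<le> C * (1 + \<bar>real_of_int n\<bar>)"
    "\<And>u m. schro_seq V (band_app r y u) m - band_app r y (schro_seq V u) m
      = of_int q * (u (m + q) - u (m - q))"
proof -
  let ?a = "\<lambda>m n. (if n = m + q \<or> m = n + q then 1 else 0) :: real"
  have per': "V (n - q) = V n" for n using per[of "n - q"] by simp
  have "lmul V ?a m n = rmul V ?a m n" for m n
  proof (cases "n = m + q \<or> m = n + q")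
    case True
    have *: "V m = V n" using True per by auto
    show ?thesis unfolding lmul_def rmul_def * by (auto simp: algebra_simps)
  next
    case False
    thus ?thesis by (auto simp: lmul_def rmul_def)
  qed
  hence com: "lmul V ?a = rmul V ?a" by blast
  have "band (nat q) ?a" using q by (auto simp: band_def)
  moreover have "?a m n = ?a n m" for m n by auto
  ultimately obtain y where "conjugate_to V ?a y"
    using conjugate_to_commuting[of V B ?a, OF B _ com] by blast
  then obtain r C where r: "band r y" and C: "\<And>m n. \<bar>y m n\<bar> \<le> C * (1 + \<bar>real_of_int n\<bar>)"
    and L: "\<And>m n. lmul V y m n - rmul V y m n = real_of_int (n - m) * ?a m n"
    unfolding conjugate_to_def by metis
  have "schro_seq V (band_app r y u) m - band_app r y (schro_seq V u) m
      = of_int q * (u (m + q) - u (m - q))" for u m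
  proof -
    let ?F = "{m - int (Suc r) - q..m + int (Suc r) + q}"
    have sup: "band_app (Suc r) z u m = (\<Sum>n\<in>?F. complex_of_real (z m n) * u n)" if "band (Suc r) z" for z
      by (rule band_app_superset[OF that]) (use q in auto)
    have "schro_seq V (band_app r y u) m - band_app r y (schro_seq V u) m
      = (\<Sum>n\<in>?F. complex_of_real (lmul V y m n - rmul V y m n) * u n)"
      unfolding schro_seq_band_app[OF r] band_app_schro_seq[OF r]
        sup[OF band_lmul[OF r]] sup[OF band_rmul[OF r]]
      by (simp add: sum_subtractf[symmetric] algebra_simps)
    \<comment> \<open>The entries of the commutator carry the factor \<open>n - m\<close> times the
      translation matrix, so only the columns \<open>m + q\<close> and \<open>m - q\<close>
      contribute, with weights \<open>q\<close> and \<open>- q\<close>.\<close>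
    also have "\<dots> = (\<Sum>n\<in>{m + q, m - q}. complex_of_real (lmul V y m n - rmul V y m n) * u n)"
      by (rule sum.mono_neutral_right) (use q in \<open>auto simp: L\<close>)
    also have "\<dots> = of_int q * (u (m + q) - u (m - q))"
      using q by (simp add: L algebra_simps)
    finally show ?thesis .
  qed
  with C show ?thesis by (rule that)
qed

text \<open>If \<open>[H, Y] = D\<close> and \<open>D\<close> commutes with \<open>H\<close>, then \<open>Y H\<^sup>k = H\<^sup>k Y - k H\<^sup>k\<^sup>-\<^sup>1 D\<close>; summing the
  exponential series, conjugation by the evolution moves \<open>Y\<close> linearly in time.\<close>

lemma conjugate_evolution:
  fixes V y r and D :: "(int \<Rightarrow> complex) \<Rightarrow> int \<Rightarrow> complex"
  defines "Y \<equiv> band_app r y" and "S \<equiv> schro_seq (apply_bcontfun V)"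
  assumes com: "\<And>u m. S (Y u) m - Y (S u) m = D u m" and DS: "\<And>u. D (S u) = S (D u)"
    and v: "ell2_nth v = Y (ell2_nth \<psi>)" and d: "ell2_nth d = D (ell2_nth \<psi>)"
  shows "ell2_nth (evolution V t (v + (\<i> * complex_of_real t) *\<^sub>C d)) m
    = Y (ell2_nth (evolution V t \<psi>)) m"
proof -
  let ?z = "- \<i> * complex_of_real t"
  let ?u = "ell2_nth \<psi>"
  let ?H = "\<lambda>k f. (S ^^ k) f m"
  have D: "D ((S ^^ k) u) = (S ^^ k) (D u)" for k u
    by (induction k) (simp_all add: DS)
  have Y: "Y ((S ^^ k) u) = (\<lambda>n. (S ^^ k) (Y u) n - of_nat k * (S ^^ (k - 1)) (D u) n)" for k u
  proof (induction k)
    case (Suc k)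
    have "Y ((S ^^ Suc k) u) = (\<lambda>n. S (Y ((S ^^ k) u)) n - D ((S ^^ k) u) n)"
      using com[of "(S ^^ k) u"] by (auto simp: algebra_simps)
    also have "S (Y ((S ^^ k) u)) = (\<lambda>n. S ((S ^^ k) (Y u)) n - of_nat k * S ((S ^^ (k - 1)) (D u)) n)"
      unfolding Suc unfolding S_def by (rule schro_seq_diff_mult)
    \<comment> \<open>At \<open>k = 0\<close> the truncated exponent \<open>k - 1\<close> does no
      harm, since the factor \<open>of_nat k\<close> vanishes.\<close>
    also have "(\<lambda>n. of_nat k * S ((S ^^ (k - 1)) (D u)) n) = (\<lambda>n. of_nat k * (S ^^ k) (D u) n)"
      by (cases k) auto
    hence "(\<lambda>n. S ((S ^^ k) (Y u)) n - of_nat k * S ((S ^^ (k - 1)) (D u)) n)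
       = (\<lambda>n. S ((S ^^ k) (Y u)) n - of_nat k * (S ^^ k) (D u) n)" by (metis (no_types))
    finally show ?case by (simp add: D algebra_simps)
  qed simp
  have sums: "(\<lambda>k. ?z ^ k / fact k * (S ^^ k) (ell2_nth w) n) sums ell2_nth (evolution V t w) n" for w n
    unfolding S_def by (rule evolution_nth_sums)
  have "(\<lambda>k. \<Sum>n = m - int r..m + int r. complex_of_real (y m n) * (?z ^ k / fact k * (S ^^ k) ?u n))
      sums Y (ell2_nth (evolution V t \<psi>)) m"
    unfolding Y_def band_app_def by (intro sums_sum sums_mult sums)
  moreover have "(\<Sum>n = m - int r..m + int r. complex_of_real (y m n) * (?z ^ k / fact k * (S ^^ k) ?u n))
      = ?z ^ k / fact k * Y ((S ^^ k) ?u) m" for k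
    by (simp add: Y_def band_app_def sum_distrib_left mult_ac)
  ultimately have 1: "(\<lambda>k. ?z ^ k / fact k * (?H k (Y ?u) - of_nat k * ?H (k - 1) (D ?u)))
      sums Y (ell2_nth (evolution V t \<psi>)) m"
    by (simp only: Y)
  let ?g = "\<lambda>k. ?z ^ k / fact k * (of_nat k * ?H (k - 1) (D ?u))"
  have "?z ^ Suc k / fact (Suc k) * (of_nat (Suc k) * x) = ?z * (?z ^ k / fact k * x)" for k x
  proof -
    have "of_nat (Suc k) \<noteq> (0::complex)" by (simp del: of_nat_Suc)
    thus ?thesis unfolding fact_Suc of_nat_mult power_Suc by (simp add: field_simps del: of_nat_Suc)
  qed
  hence "?g (Suc k) = ?z * (?z ^ k / fact k * ?H k (D ?u))" for k by (simp only: diff_Suc_1)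
  hence "(\<lambda>k. ?g (Suc k)) sums (?z * ell2_nth (evolution V t d) m)"
    using sums_mult[OF sums[of d m], of ?z] by (simp only: d)
  \<comment> \<open>Shifting the index loses only the term \<open>k = 0\<close>, which is
    zero.\<close>
  hence 2: "?g sums (?z * ell2_nth (evolution V t d) m)"
    by (subst (asm) sums_Suc_iff) simp
  have "(\<lambda>k. ?z ^ k / fact k * ?H k (Y ?u) - ?z * (?z ^ k / fact k * ?H k (D ?u))) sums
      (ell2_nth (evolution V t v) m - ?z * ell2_nth (evolution V t d) m)"
    using sums_diff[OF sums[of v m] sums_mult[OF sums[of d m], of ?z]] by (simp only: v d)
  moreover have "ell2_nth (v + (\<i> * complex_of_real t) *\<^sub>C d) = (\<lambda>n. Y ?u n - ?z * D ?u n)"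
    using v d by auto
  hence "(S ^^ k) (ell2_nth (v + (\<i> * complex_of_real t) *\<^sub>C d))
      = (\<lambda>n. (S ^^ k) (Y ?u) n - ?z * (S ^^ k) (D ?u) n)" for k
    unfolding S_def by (simp only: schro_seq_pow_diff_mult)
  hence "?z ^ k / fact k * ?H k (ell2_nth (v + (\<i> * complex_of_real t) *\<^sub>C d))
    = ?z ^ k / fact k * ?H k (Y ?u) - ?z * (?z ^ k / fact k * ?H k (D ?u))" for k
    by (simp only: right_diff_distrib mult.left_commute)
  ultimately have "ell2_nth (evolution V t (v + (\<i> * complex_of_real t) *\<^sub>C d)) m
     = ell2_nth (evolution V t v) m - ?z * ell2_nth (evolution V t d) m"
    using sums[of "v + (\<i> * complex_of_real t) *\<^sub>C d" m] by (simp only: sums_unique2)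
  moreover have "Y (ell2_nth (evolution V t \<psi>)) m = ell2_nth (evolution V t v) m - ?z * ell2_nth (evolution V t d) m"
  proof (rule sums_unique2[OF 1])
    show "(\<lambda>k. ?z ^ k / fact k * (?H k (Y ?u) - of_nat k * ?H (k - 1) (D ?u))) sums
      (ell2_nth (evolution V t v) m - ?z * ell2_nth (evolution V t d) m)"
      using sums_diff[OF sums[of v m] 2] by (simp only: right_diff_distrib v)
  qed
  ultimately show ?thesis by simp
qed

text \<open>By unitarity, \<open>Y \<psi>(t)\<close> and \<open>Y \<psi> + i t q D \<psi>\<close>
  have equal norms; each \<open>Y\<close> term costs at most a multiple of the weighted norm, and
  one coordinate of \<open>D \<psi>\<close> bounds its norm from below. The constant comes from
  \<open>Y\<close> alone, hence is uniform in \<open>t\<close>, \<open>\<psi>\<close> and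
  \<open>m\<close>.\<close>

lemma periodic_ballistic:
  assumes q: "q > 0" and per: "\<And>n. apply_bcontfun V (n + q) = apply_bcontfun V n"
  obtains C where "C > 0"
    "\<And>t \<psi> m. \<lbrakk>t \<ge> 0; in_domain \<psi>; in_domain (evolution V t \<psi>)\<rbrakk> \<Longrightarrow>
       t * cmod (ell2_nth \<psi> (m + q) - ell2_nth \<psi> (m - q))
         \<le> C * (norm (weighted \<psi>) + norm (weighted (evolution V t \<psi>)))"
proof -
  have "\<bar>apply_bcontfun V n\<bar> \<le> norm V" for n using norm_bounded[of V n] by simp
  with q per obtain r y C where C: "\<And>m n. \<bar>y m n\<bar> \<le> C * (1 + \<bar>real_of_int n\<bar>)"
    and com: "\<And>u m. schro_seq V (band_app r y u) m - band_app r y (schro_seq V u) m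
      = of_int q * (u (m + q) - u (m - q))"
    by (rule periodic_conjugate_operator) blast
  have C0: "C \<ge> 0" using C[of 0 0] by simp
  \<comment> \<open>The factor \<open>2 r + 1\<close> counts diagonals; \<open>C + 1\<close>
    replaces \<open>C\<close> to make the constant strictly positive.\<close>
  let ?C = "(2 * real r + 1) * (C + 1)"
  define D :: "(int \<Rightarrow> complex) \<Rightarrow> int \<Rightarrow> complex"
    where "D u m = of_int q * (u (m + q) - u (m - q))" for u m
  have per': "apply_bcontfun V (n - q) = apply_bcontfun V n" for n using per[of "n - q"] by simp
  have DS: "D (schro_seq V u) = schro_seq V (D u)" for u
    by (auto simp: D_def schro_seq_def per per' algebra_simps)
  have bound: "t * cmod (ell2_nth \<psi> (m + q) - ell2_nth \<psi> (m - q))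
      \<le> ?C * (norm (weighted \<psi>) + norm (weighted (evolution V t \<psi>)))"
    if t: "t \<ge> 0" and dom: "in_domain \<psi>" "in_domain (evolution V t \<psi>)" for t \<psi> m
  proof -
    obtain v where v: "ell2_nth v = band_app r y (ell2_nth \<psi>)"
      and vn: "norm v \<le> (2 * real r + 1) * (C * norm (weighted \<psi>))"
      using band_app_ell2[of y C, OF C dom(1)] by blast
    obtain v' where v': "ell2_nth v' = band_app r y (ell2_nth (evolution V t \<psi>))"
      and vn': "norm v' \<le> (2 * real r + 1) * (C * norm (weighted (evolution V t \<psi>)))"
      using band_app_ell2[of y C, OF C dom(2)] by blast
    obtain a where a: "ell2_nth a = (\<lambda>n. ell2_nth \<psi> (n + q))"
      using ell2_dominated[of 1 "\<lambda>n. ell2_nth \<psi> (n + q)" \<psi> q] by auto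
    obtain b where b: "ell2_nth b = (\<lambda>n. ell2_nth \<psi> (n - q))"
      using ell2_dominated[of 1 "\<lambda>n. ell2_nth \<psi> (n - q)" \<psi> "- q"] by auto
    let ?d = "of_int q *\<^sub>C (a - b)" and ?it = "\<i> * complex_of_real t"
    have d: "ell2_nth ?d = D (ell2_nth \<psi>)" by (auto simp: D_def a b)
    have "ell2_nth (evolution V t (v + ?it *\<^sub>C ?d)) n = ell2_nth v' n" for n
      unfolding v' by (rule conjugate_evolution[OF _ DS v d]) (simp add: com D_def)
    hence "evolution V t (v + ?it *\<^sub>C ?d) = v'" by (intro ell2_eqI)
    hence eq: "norm (v + ?it *\<^sub>C ?d) = norm v'" by (metis norm_evolution)
    have "t * cmod (ell2_nth \<psi> (m + q) - ell2_nth \<psi> (m - q))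
      \<le> real_of_int q * (t * cmod (ell2_nth \<psi> (m + q) - ell2_nth \<psi> (m - q)))"
      using q t by (intro mult_right_mono[of 1 "real_of_int q", simplified]) auto
    also have "\<dots> = cmod (ell2_nth (?it *\<^sub>C ?d) m)"
      using q t by (simp add: a b norm_mult)
    also have "\<dots> \<le> norm (?it *\<^sub>C ?d)" by (rule norm_nth_ell2)
    also have "\<dots> \<le> norm v' + norm v"
      using norm_triangle_ineq4[of "v + ?it *\<^sub>C ?d" v] by (simp add: eq)
    also have "\<dots> \<le> (2 * real r + 1) * (C * (norm (weighted \<psi>) + norm (weighted (evolution V t \<psi>))))"
      using vn vn' by (simp add: algebra_simps)
    also have "\<dots> \<le> (2 * real r + 1) * ((C + 1) * (norm (weighted \<psi>) + norm (weighted (evolution V t \<psi>))))"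
      by (intro mult_left_mono mult_right_mono) auto
    finally show ?thesis by (simp only: mult.assoc)
  qed
  have "?C > 0" using C0 by simp
  with bound show ?thesis by (intro that[of ?C]) auto
qed


subsection \<open>Exponential bounds along the evolution\<close>

text \<open>Keeps the constants of exponential decay explicit, since the later estimates must be
  uniform over a class of states.\<close>

definition exp_bound :: "real \<Rightarrow> real \<Rightarrow> ell2 \<Rightarrow> bool" where
  "exp_bound K c u \<longleftrightarrow> (\<forall>n. cmod (ell2_nth u n) \<le> K * exp (- c * \<bar>real_of_int n\<bar>))"

lemma exp_bound_nonneg: "exp_bound K c u \<Longrightarrow> K \<ge> 0"
  unfolding exp_bound_def by (drule spec[of _ 0]) (auto intro: order_trans[OF norm_ge_zero])

text \<open>Moving to a neighbouring site changes the exponential weight by a factor of at most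
  \<open>exp c\<close>.\<close>

lemma schro_seq_exp_bound:
  assumes "\<And>n. \<bar>V n\<bar> \<le> B" "c \<ge> 0" and f: "\<And>n. cmod (f n) \<le> M * exp (- c * \<bar>real_of_int n\<bar>)"
  shows "cmod (schro_seq V f n) \<le> (2 * exp c + B) * M * exp (- c * \<bar>real_of_int n\<bar>)"
proof -
  let ?e = "\<lambda>n::int. exp (- c * \<bar>real_of_int n\<bar>)"
  have M: "M \<ge> 0" using f[of 0] by (auto intro: order_trans[OF norm_ge_zero])
  have B: "B \<ge> 0" using assms(1)[of 0] by linarith
  have nb: "cmod (f m) \<le> M * (exp c * ?e n)" if "\<bar>n - m\<bar> \<le> 1" for m
  proof -
    have "\<bar>real_of_int n\<bar> \<le> \<bar>real_of_int m\<bar> + 1" using that by linarith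
    hence "c * \<bar>real_of_int n\<bar> \<le> c * (\<bar>real_of_int m\<bar> + 1)" using assms(2) by (intro mult_left_mono) auto
    hence "?e m \<le> exp c * ?e n" by (simp add: exp_add[symmetric] algebra_simps)
    thus ?thesis using f[of m] M mult_left_mono order_trans by blast
  qed
  have "\<bar>V n\<bar> * cmod (f n) \<le> B * (M * ?e n)"
    using assms(1) f B by (intro mult_mono) auto
  moreover have "cmod (schro_seq V f n) \<le> cmod (f (n + 1)) + cmod (f (n - 1)) + \<bar>V n\<bar> * cmod (f n)"
    unfolding schro_seq_def
    by (intro norm_triangle_le add_mono norm_triangle_ineq) (simp add: norm_mult)
  ultimately have "cmod (schro_seq V f n) \<le> M * (exp c * ?e n) + M * (exp c * ?e n) + B * (M * ?e n)"
    using nb[of "n + 1"] nb[of "n - 1"] by simp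
  thus ?thesis by (simp add: algebra_simps)
qed

lemma schro_seq_pow_exp_bound:
  assumes "\<And>n. \<bar>V n\<bar> \<le> B" "c \<ge> 0" "\<And>n. cmod (f n) \<le> K * exp (- c * \<bar>real_of_int n\<bar>)"
  shows "cmod ((schro_seq V ^^ k) f n) \<le> (2 * exp c + B) ^ k * (K * exp (- c * \<bar>real_of_int n\<bar>))"
proof (induction k arbitrary: n)
  case (Suc k)
  show ?case
    using schro_seq_exp_bound[of V B c "(schro_seq V ^^ k) f" "(2 * exp c + B) ^ k * K" n] assms(1,2) Suc
    by (simp add: mult_ac)
qed (use assms in simp)

text \<open>With \<open>v\<close> and \<open>w\<close> the \<open>k\<close>-th iterates, the next
  difference is \<open>H_V (v - w) + (V - W) w\<close>. The extra 1 in the base absorbs the second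
  term: \<open>C (C + 1)^k + (C + 1)^k = (C + 1)^(k + 1)\<close>.\<close>

lemma schro_seq_pow_diff_exp_bound:
  assumes V: "\<And>n. \<bar>V n\<bar> \<le> B" and W: "\<And>n. \<bar>W n\<bar> \<le> B" and VW: "\<And>n. \<bar>V n - W n\<bar> \<le> \<delta>" and c: "c \<ge> 0"
    and f: "\<And>n. cmod (f n) \<le> K * exp (- c * \<bar>real_of_int n\<bar>)"
  shows "cmod ((schro_seq V ^^ k) f n - (schro_seq W ^^ k) f n)
    \<le> (2 * exp c + B + 1) ^ k * (\<delta> * K * exp (- c * \<bar>real_of_int n\<bar>))"
proof (induction k arbitrary: n)
  case 0
  have "K \<ge> 0" using f[of 0] by (auto intro: order_trans[OF norm_ge_zero])
  moreover have "\<delta> \<ge> 0" using VW[of 0] by linarith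
  ultimately show ?case by simp
next
  case (Suc k)
  let ?C = "2 * exp c + B"
  let ?e = "exp (- c * \<bar>real_of_int n\<bar>)"
  let ?v = "(schro_seq V ^^ k) f" and ?w = "(schro_seq W ^^ k) f"
  have K: "K \<ge> 0" using f[of 0] by (auto intro: order_trans[OF norm_ge_zero])
  have \<delta>: "\<delta> \<ge> 0" using VW[of 0] by linarith
  have B: "B \<ge> 0" using V[of 0] by linarith
  have 1: "cmod (schro_seq V (\<lambda>n. ?v n - ?w n) n) \<le> ?C * ((?C + 1) ^ k * (\<delta> * K)) * ?e"
    using Suc by (intro schro_seq_exp_bound[OF V c]) (simp add: mult_ac)
  have "cmod (complex_of_real (V n - W n) * ?w n) \<le> \<delta> * (?C ^ k * (K * ?e))"
    unfolding norm_mult norm_of_real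
    by (intro mult_mono VW schro_seq_pow_exp_bound W c f) (use \<delta> in auto)
  also have "\<dots> \<le> \<delta> * ((?C + 1) ^ k * (K * ?e))"
    using B K \<delta> by (intro mult_left_mono mult_right_mono power_mono) auto
  finally have 2: "cmod (complex_of_real (V n - W n) * ?w n) \<le> \<delta> * ((?C + 1) ^ k * (K * ?e))" .
  have "(schro_seq V ^^ Suc k) f n - (schro_seq W ^^ Suc k) f n
    = schro_seq V (\<lambda>n. ?v n - ?w n) n + complex_of_real (V n - W n) * ?w n"
    by (simp add: schro_seq_def algebra_simps)
  hence "cmod ((schro_seq V ^^ Suc k) f n - (schro_seq W ^^ Suc k) f n)
    \<le> ?C * ((?C + 1) ^ k * (\<delta> * K)) * ?e + \<delta> * ((?C + 1) ^ k * (K * ?e))"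
    using 1 2 by (simp only: norm_triangle_le add_mono)
  also have "\<dots> = (?C + 1) ^ Suc k * (\<delta> * K * ?e)" by (simp add: algebra_simps)
  finally show ?case .
qed

lemma exp_series_norm_le:
  fixes z s :: complex
  assumes S: "(\<lambda>k. z ^ k / fact k * g k) sums s" and g: "\<And>k. cmod (g k) \<le> a ^ k * M"
  shows "cmod s \<le> exp (cmod z * a) * M"
proof -
  have E: "(\<lambda>k. (cmod z * a) ^ k /\<^sub>R fact k * M) sums (exp (cmod z * a) * M)"
    by (intro sums_mult2 exp_converges)
  have "norm (suminf (\<lambda>k. z ^ k / fact k * g k)) \<le> (\<Sum>k. (cmod z * a) ^ k /\<^sub>R fact k * M)"
  proof (rule norm_suminf_le)
    fix k
    have "norm (z ^ k / fact k * g k) \<le> (cmod z ^ k / fact k) * (a ^ k * M)"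
      unfolding norm_mult norm_divide norm_power using g by (intro mult_mono) auto
    thus "norm (z ^ k / fact k * g k) \<le> (cmod z * a) ^ k /\<^sub>R fact k * M"
      by (simp add: power_mult_distrib divide_inverse mult_ac)
  qed (use E in \<open>simp add: sums_iff\<close>)
  thus ?thesis using S E by (simp add: sums_iff)
qed

lemma evolution_exp_bound:
  assumes "exp_bound K c \<psi>" "c \<ge> 0" "norm V \<le> B" "t \<ge> 0"
  shows "exp_bound (exp (t * (2 * exp c + B)) * K) c (evolution V t \<psi>)"
  unfolding exp_bound_def
proof
  fix n
  have V: "\<bar>apply_bcontfun V n\<bar> \<le> B" for n using norm_bounded[of V n] assms(3) by simp
  have "cmod (ell2_nth (evolution V t \<psi>) n)
    \<le> exp (cmod (- \<i> * complex_of_real t) * (2 * exp c + B)) * (K * exp (- c * \<bar>real_of_int n\<bar>))"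
    by (rule exp_series_norm_le[OF evolution_nth_sums schro_seq_pow_exp_bound[OF V assms(2)]])
      (use assms(1) in \<open>auto simp: exp_bound_def\<close>)
  thus "cmod (ell2_nth (evolution V t \<psi>) n)
    \<le> exp (t * (2 * exp c + B)) * K * exp (- c * \<bar>real_of_int n\<bar>)"
    using assms(4) by (simp add: norm_mult)
qed

text \<open>Continuity in the potential at a fixed time, measured by an exponential weight.
  Closeness in \<open>ell2\<close> alone would not control the unbounded weight in
  \<open>weighted\<close>.\<close>

lemma evolution_diff_exp_bound:
  assumes "exp_bound K c \<psi>" "c \<ge> 0" "norm V \<le> B" "norm W \<le> B" "t \<ge> 0"
  shows "exp_bound (exp (t * (2 * exp c + B + 1)) * (norm (V - W) * K)) c (evolution V t \<psi> - evolution W t \<psi>)"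
  unfolding exp_bound_def
proof
  fix n
  have V: "\<bar>apply_bcontfun V n\<bar> \<le> B" for n using norm_bounded[of V n] assms(3) by simp
  have W: "\<bar>apply_bcontfun W n\<bar> \<le> B" for n using norm_bounded[of W n] assms(4) by simp
  have VW: "\<bar>apply_bcontfun V n - apply_bcontfun W n\<bar> \<le> norm (V - W)" for n
    using norm_bounded[of "V - W" n] by (simp add: minus_bcontfun.rep_eq)
  have "(\<lambda>k. (- \<i> * complex_of_real t) ^ k / fact k * ((schro_seq (apply_bcontfun V) ^^ k) (ell2_nth \<psi>) n
      - (schro_seq (apply_bcontfun W) ^^ k) (ell2_nth \<psi>) n)) sums
      ell2_nth (evolution V t \<psi> - evolution W t \<psi>) n"
    using sums_diff[OF evolution_nth_sums[of t V \<psi> n] evolution_nth_sums[of t W \<psi> n]]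
    by (simp only: right_diff_distrib ell2_nth_simps)
  hence "cmod (ell2_nth (evolution V t \<psi> - evolution W t \<psi>) n)
    \<le> exp (cmod (- \<i> * complex_of_real t) * (2 * exp c + B + 1)) * (norm (V - W) * K * exp (- c * \<bar>real_of_int n\<bar>))"
    by (rule exp_series_norm_le[OF _ schro_seq_pow_diff_exp_bound[OF V W VW assms(2)]])
      (use assms(1) in \<open>auto simp: exp_bound_def\<close>)
  thus "cmod (ell2_nth (evolution V t \<psi> - evolution W t \<psi>) n)
    \<le> exp (t * (2 * exp c + B + 1)) * (norm (V - W) * K) * exp (- c * \<bar>real_of_int n\<bar>)"
    using assms(5) by (simp add: norm_mult)
qed

text \<open>\<open>N\<close> is the norm of the sequence \<open>(1 + |n|) exp (- c |n|)\<close>, so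
  it depends on \<open>c\<close> only.\<close>

lemma exp_bound_weighted:
  assumes c: "c > 0"
  obtains N where "N \<ge> 0" "\<And>K u. exp_bound K c u \<Longrightarrow> in_domain u \<and> norm (weighted u) \<le> K * N"
proof -
  let ?h = "\<lambda>n::int. complex_of_real ((1 + \<bar>real_of_int n\<bar>) * exp (- c * \<bar>real_of_int n\<bar>))"
  let ?A = "1 + 2 / c"
  have h: "cmod (?h n) = (1 + \<bar>real_of_int n\<bar>) * exp (- c * \<bar>real_of_int n\<bar>)" for n
    unfolding norm_of_real by simp
  have "(\<lambda>n. (cmod (?h n))\<^sup>2) summable_on UNIV"
  proof (rule sq_summable_dominated)
    show "(\<lambda>n::int. ?A\<^sup>2 * exp (- c * \<bar>real_of_int n\<bar>)) summable_on UNIV"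
      by (intro summable_on_cmult_right summable_on_exp_decay c)
    fix n :: int
    let ?x = "\<bar>real_of_int n\<bar>"
    \<comment> \<open>Half of the decay rate pays for the polynomial weight; squaring then restores
      the rate \<open>c\<close>.\<close>
    have "1 + ?x \<le> ?A * (1 + c / 2 * ?x)" using c by (simp add: field_simps)
    also have "\<dots> \<le> ?A * exp (c / 2 * ?x)" using c by (intro mult_left_mono exp_ge_add_one_self) auto
    finally have "((1 + ?x) * exp (- c * ?x))\<^sup>2 \<le> (?A * exp (c / 2 * ?x) * exp (- c * ?x))\<^sup>2"
      by (intro power_mono mult_right_mono) auto
    also have "?A * exp (c / 2 * ?x) * exp (- c * ?x) = ?A * exp (- (c / 2) * ?x)"
      by (simp add: mult.assoc exp_add[symmetric] field_simps)
    also have "(?A * exp (- (c / 2) * ?x))\<^sup>2 = ?A\<^sup>2 * exp (- c * ?x)"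
      by (simp add: power_mult_distrib power2_eq_square exp_add[symmetric])
    finally show "(cmod (?h n))\<^sup>2 \<le> ?A\<^sup>2 * exp (- c * ?x)" unfolding h .
  qed
  then obtain w where w: "ell2_nth w = ?h" using Abs_ell2_inverse[of ?h] by auto
  have "in_domain u \<and> norm (weighted u) \<le> K * norm w" if u: "exp_bound K c u" for K u
  proof -
    let ?f = "\<lambda>n. complex_of_real (1 + \<bar>real_of_int n\<bar>) * ell2_nth u n"
    have "\<exists>v. ell2_nth v = ?f \<and> norm v \<le> K * norm w"
    proof (rule ell2_dominated[of _ _ _ 0])
      fix n
      have "cmod (?f n) = (1 + \<bar>real_of_int n\<bar>) * cmod (ell2_nth u n)"
        by (simp only: norm_mult norm_of_real)
      also have "\<dots> \<le> (1 + \<bar>real_of_int n\<bar>) * (K * exp (- c * \<bar>real_of_int n\<bar>))"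
        using u by (intro mult_left_mono) (auto simp: exp_bound_def)
      also have "\<dots> = K * cmod (ell2_nth w n)" unfolding w h by (simp only: mult_ac)
      finally show "cmod (?f n) \<le> K * cmod (ell2_nth w (n + 0))" by simp
    qed (use exp_bound_nonneg[OF u] in simp)
    thus ?thesis using in_domainI by blast
  qed
  thus ?thesis by (intro that[of "norm w"]) auto
qed

lemma weighted_diff:
  assumes "in_domain u" "in_domain v"
  shows "weighted (u - v) = weighted u - weighted v"
  by (rule in_domainI(2)) (use assms in \<open>auto simp: in_domain_def algebra_simps\<close>)

subsection \<open>The generic set\<close>

text \<open>The second condition bounds the lower estimate of \<open>periodic_ballistic\<close> away from zero uniformly
  in the period.\<close>

definition initial_states :: "nat \<Rightarrow> ell2 set" where
  "initial_states l = {\<psi>. exp_bound (real (Suc l)) (1 / real (Suc l)) \<psi> \<and>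
     (\<forall>q>0. \<exists>m. 1 / real (Suc l) \<le> cmod (ell2_nth \<psi> (m + q) - ell2_nth \<psi> (m - q)))}"

text \<open>The slack \<open>\<eta>\<close> makes the set open.\<close>

definition fast_potentials :: "nat \<Rightarrow> (int \<Rightarrow>\<^sub>C real) set" where
  "fast_potentials l = {V. \<exists>T>real l. \<exists>\<eta>>0. \<forall>\<psi>\<in>initial_states l.
     T / ln T + \<eta> \<le> norm (weighted (evolution V T \<psi>))}"

text \<open>If all differences over distance \<open>2 q\<close> were small, a nonzero value at
  \<open>n\<close> would persist along \<open>n, n + 2 q, n + 4 q, ...\<close>, against the decay.
  The number of steps needed can be chosen independently of \<open>q\<close>, which gives a gap
  uniform in the period.\<close>

lemma exp_decaying_initial_states:
  assumes "exp_decaying \<psi>" "\<psi> \<noteq> 0"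
  obtains l0 where "\<And>l. l \<ge> l0 \<Longrightarrow> \<psi> \<in> initial_states l"
proof -
  let ?u = "ell2_nth \<psi>"
  obtain K c where K: "K > 0" and c: "c > 0"
    and dec: "\<And>n. cmod (?u n) \<le> K * exp (- c * \<bar>real_of_int n\<bar>)"
    using assms(1) unfolding exp_decaying_def by blast
  obtain n where "?u n \<noteq> 0" using assms(2) ell2_eqI[of \<psi> 0] by auto
  define a where "a = cmod (?u n)"
  have a: "a > 0" using \<open>?u n \<noteq> 0\<close> by (simp add: a_def)
  obtain j :: nat where j: "4 * K / a < real j * c" using c reals_Archimedean3 by blast
  \<comment> \<open>Ensures \<open>n + 2 q k >= j\<close> for every \<open>q >= 1\<close>, where the
    state is at most \<open>a / 4\<close>.\<close>
  define k where "k = j + nat \<bar>n\<bar> + 1"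
  have small: "cmod (?u m) \<le> a / 4" if "m \<ge> int j" for m
  proof -
    have "4 * K / a \<le> 1 + c * \<bar>real_of_int m\<bar>"
    proof -
      have "real j * c \<le> \<bar>real_of_int m\<bar> * c" using that c by (intro mult_right_mono) auto
      thus ?thesis using j by (simp add: mult.commute)
    qed
    also have "\<dots> \<le> exp (c * \<bar>real_of_int m\<bar>)" by (rule exp_ge_add_one_self)
    finally have "K * exp (- c * \<bar>real_of_int m\<bar>) \<le> a / 4"
      using a by (simp add: exp_minus field_simps)
    thus ?thesis using dec[of m] by linarith
  qed
  \<comment> \<open>With this choice \<open>k\<close> steps lose at most \<open>a / 2\<close>, so at
    least \<open>a / 2\<close> would remain where only \<open>a / 4\<close> is allowed.\<close>
  define \<epsilon> where "\<epsilon> = a / (2 * real k)"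
  have \<epsilon>: "\<epsilon> > 0" using a by (simp add: \<epsilon>_def k_def)
  have diff: "\<exists>m. \<epsilon> \<le> cmod (?u (m + q) - ?u (m - q))" if q: "q > 0" for q
  proof (rule ccontr)
    assume "\<not> ?thesis"
    hence less: "cmod (?u (m + q) - ?u (m - q)) \<le> \<epsilon>" for m by (metis linear)
    have "cmod (?u n - ?u (n + 2 * q * int i)) \<le> real i * \<epsilon>" for i
    proof (induction i)
      case (Suc i)
      have "cmod (?u (n + 2 * q * int i) - ?u (n + 2 * q * int (Suc i))) \<le> \<epsilon>"
        using less[of "n + 2 * q * int i + q"] by (simp add: norm_minus_commute algebra_simps)
      thus ?case
        using Suc norm_triangle_ineq[of "?u n - ?u (n + 2 * q * int i)" "?u (n + 2 * q * int i) - ?u (n + 2 * q * int (Suc i))"]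
        by (simp add: algebra_simps)
    qed simp
    moreover have "real k * \<epsilon> = a / 2" by (simp add: \<epsilon>_def k_def del: of_nat_add of_nat_Suc)
    ultimately have "cmod (?u n - ?u (n + 2 * q * int k)) \<le> a / 2" by metis
    moreover have "2 * q * int k \<ge> int k" using q by (simp add: mult_le_cancel_right1)
    hence "cmod (?u (n + 2 * q * int k)) \<le> a / 4" by (intro small) (auto simp: k_def)
    ultimately have "cmod (?u n) \<le> a / 2 + a / 4"
      using norm_triangle_ineq2[of "?u n" "?u (n + 2 * q * int k)"] by linarith
    thus False using a by (simp add: a_def)
  qed
  obtain l0 :: nat where l0: "max K (max (1 / c) (1 / \<epsilon>)) < real l0" using reals_Archimedean2 by blast
  have "\<psi> \<in> initial_states l" if "l \<ge> l0" for l
  proof -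
    let ?l = "real (Suc l)"
    have "K \<le> ?l" "1 / c \<le> ?l" "1 / \<epsilon> \<le> ?l" using l0 that by auto
    hence l: "K \<le> ?l" "1 / ?l \<le> c" "1 / ?l \<le> \<epsilon>" using c \<epsilon> by (auto simp: field_simps)
    have "cmod (?u m) \<le> ?l * exp (- (1 / ?l) * \<bar>real_of_int m\<bar>)" for m
    proof -
      have "- c * \<bar>real_of_int m\<bar> \<le> - (1 / ?l) * \<bar>real_of_int m\<bar>"
        using l(2) by (intro mult_right_mono) auto
      hence "K * exp (- c * \<bar>real_of_int m\<bar>) \<le> ?l * exp (- (1 / ?l) * \<bar>real_of_int m\<bar>)"
        using l(1) K by (intro mult_mono) auto
      with dec[of m] show ?thesis by linarith
    qed
    moreover have "\<exists>m. 1 / ?l \<le> cmod (?u (m + q) - ?u (m - q))" if "q > 0" for q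
      using diff[OF that] l(3) order_trans by blast
    ultimately show ?thesis unfolding initial_states_def exp_bound_def by blast
  qed
  thus ?thesis by (rule that)
qed

text \<open>At the fixed time \<open>T\<close>, the weighted evolved state is Lipschitz in the
  potential on a ball of radius 1, uniformly over \<open>initial_states l\<close>. A small
  perturbation therefore uses up at most half of the slack.\<close>

lemma open_fast_potentials: "open (fast_potentials l)"
  unfolding open_dist
proof
  fix V assume "V \<in> fast_potentials l"
  then obtain T \<eta> where T: "T > real l" and \<eta>: "\<eta> > 0"
    and V: "\<And>\<psi>. \<psi> \<in> initial_states l \<Longrightarrow> T / ln T + \<eta> \<le> norm (weighted (evolution V T \<psi>))"
    unfolding fast_potentials_def by blast
  let ?K = "real (Suc l)"
  let ?c = "1 / ?K"
  let ?B = "norm V + 1"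
  have T0: "T \<ge> 0" using T by linarith
  have c: "?c > 0" by simp
  obtain N where N: "N \<ge> 0" "\<And>K u. exp_bound K ?c u \<Longrightarrow> in_domain u \<and> norm (weighted u) \<le> K * N"
    using exp_bound_weighted[OF c] by metis
  \<comment> \<open>The Lipschitz constant, increased by 1 so that it can be divided by.\<close>
  define M where "M = exp (T * (2 * exp ?c + ?B + 1)) * (?K * N) + 1"
  have M: "M > 0" using N(1) by (auto simp: M_def intro!: add_nonneg_pos mult_nonneg_nonneg)
  have "W \<in> fast_potentials l" if W: "dist W V < min 1 (\<eta> / (2 * M))" for W
  proof -
    have nW: "norm W \<le> ?B" using W norm_triangle_ineq2[of W V] by (simp add: dist_norm)
    have "T / ln T + \<eta> / 2 \<le> norm (weighted (evolution W T \<psi>))" if \<psi>: "\<psi> \<in> initial_states l" for \<psi>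
    proof -
      have dec: "exp_bound ?K ?c \<psi>" using \<psi> by (simp add: initial_states_def)
      have dom: "in_domain (evolution V T \<psi>)" "in_domain (evolution W T \<psi>)"
        using evolution_exp_bound[OF dec _ _ T0, of V ?B] evolution_exp_bound[OF dec _ nW T0] N(2) by auto
      have "norm (weighted (evolution V T \<psi>)) - norm (weighted (evolution W T \<psi>))
          \<le> norm (weighted (evolution V T \<psi> - evolution W T \<psi>))"
        unfolding weighted_diff[OF dom] by (rule norm_triangle_ineq2)
      also have "\<dots> \<le> exp (T * (2 * exp ?c + ?B + 1)) * (norm (V - W) * ?K) * N"
        using N(2) evolution_diff_exp_bound[OF dec _ _ nW T0, of V] by force
      also have "\<dots> = norm (V - W) * (M - 1)" by (simp add: M_def)
      also have "\<dots> \<le> norm (V - W) * M" by (intro mult_left_mono) auto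
      also have "\<dots> \<le> \<eta> / (2 * M) * M"
        using W M by (intro mult_right_mono) (simp_all add: dist_norm norm_minus_commute)
      also have "\<dots> = \<eta> / 2" using M by simp
      finally show ?thesis using V[OF \<psi>] by linarith
    qed
    thus ?thesis unfolding fast_potentials_def using T \<eta> half_gt_zero by blast
  qed
  moreover have "min 1 (\<eta> / (2 * M)) > 0" using \<eta> M by simp
  ultimately show "\<exists>e>0. \<forall>W. dist W V < e \<longrightarrow> W \<in> fast_potentials l" by blast
qed

text \<open>For a fixed periodic potential the growth is at least \<open>a T - b\<close> with
  \<open>a\<close> and \<open>b\<close> common to all states of the class, and this eventually
  exceeds \<open>T / ln T + 1\<close>.\<close>

lemma periodic_fast_potentials:
  assumes "periodic V"
  shows "V \<in> fast_potentials l"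
proof -
  obtain q where q: "q > 0" "\<And>n. apply_bcontfun V (n + q) = apply_bcontfun V n"
    using assms unfolding periodic_def by blast
  obtain C where C: "C > 0" and bal: "\<And>t \<psi> m. \<lbrakk>t \<ge> 0; in_domain \<psi>; in_domain (evolution V t \<psi>)\<rbrakk> \<Longrightarrow>
       t * cmod (ell2_nth \<psi> (m + q) - ell2_nth \<psi> (m - q))
         \<le> C * (norm (weighted \<psi>) + norm (weighted (evolution V t \<psi>)))"
    using periodic_ballistic[OF q] by metis
  let ?K = "real (Suc l)"
  let ?c = "1 / ?K"
  have c: "?c > 0" by simp
  obtain N where N: "N \<ge> 0" "\<And>K u. exp_bound K ?c u \<Longrightarrow> in_domain u \<and> norm (weighted u) \<le> K * N"
    using exp_bound_weighted[OF c] by metis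
  define a where "a = 1 / (?K * C)"
  define b where "b = ?K * N"
  have a: "a > 0" using C by (simp add: a_def)
  have "\<forall>\<^sub>F T in at_top. T / ln T + 1 \<le> a * T - b" using a by real_asymp
  hence "\<forall>\<^sub>F T in at_top. T > real l \<and> T / ln T + 1 \<le> a * T - b"
    using eventually_gt_at_top eventually_conj by blast
  then obtain T where T: "T > real l" "T / ln T + 1 \<le> a * T - b"
    using eventually_happens by fastforce
  have T0: "T \<ge> 0" using T by linarith
  have "T / ln T + 1 \<le> norm (weighted (evolution V T \<psi>))" if \<psi>: "\<psi> \<in> initial_states l" for \<psi>
  proof -
    have dec: "exp_bound ?K ?c \<psi>" using \<psi> by (simp add: initial_states_def)
    have dom: "in_domain \<psi>" "in_domain (evolution V T \<psi>)"
      using dec evolution_exp_bound[OF dec _ order_refl T0, of V] N(2) by auto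
    obtain m where "?c \<le> cmod (ell2_nth \<psi> (m + q) - ell2_nth \<psi> (m - q))"
      using \<psi> q(1) by (auto simp: initial_states_def)
    hence "T * ?c \<le> C * (norm (weighted \<psi>) + norm (weighted (evolution V T \<psi>)))"
      using bal[OF T0 dom, of m] T0 by (meson mult_left_mono order_trans)
    also have "norm (weighted \<psi>) \<le> b" unfolding b_def using N(2) dec by blast
    finally have *: "T * ?c \<le> C * (b + norm (weighted (evolution V T \<psi>)))" using C by simp
    have "a * T \<le> b + norm (weighted (evolution V T \<psi>))"
    proof -
      have "a * T = (T * ?c) / C" by (simp add: a_def field_simps)
      also have "\<dots> \<le> b + norm (weighted (evolution V T \<psi>))"
        using * C by (subst pos_divide_le_eq) (simp_all only: mult.commute)
      finally show ?thesis .
    qed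
    thus ?thesis using T by linarith
  qed
  thus ?thesis unfolding fast_potentials_def using T(1) zero_less_one by blast
qed

section \<open>Baire category in the space of limit-periodic potentials\<close>

lemma limit_periodic_closure: "limit_periodic = closure {V. periodic V}"
  unfolding limit_periodic_def set_eq_iff closure_sequential mem_Collect_eq by blast

text \<open>The library has this only over metric domains, and \<open>int\<close> is not an instance of that class.\<close>

lemma complete_UNIV_bcontfun: "complete (UNIV :: ('a::topological_space \<Rightarrow>\<^sub>C 'b::complete_space) set)"
  unfolding complete_def
proof (intro allI impI, elim conjE)
  fix f :: "nat \<Rightarrow> 'a \<Rightarrow>\<^sub>C 'b" assume f: "Cauchy f"
  have "\<exists>N. \<forall>m n x. N \<le> m \<and> N \<le> n \<and> True \<longrightarrow> dist (f m x) (f n x) < e" if "e > 0" for e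
    using metric_CauchyD[OF f that] dist_bounded order_le_less_trans by metis
  then obtain g where "uniform_limit UNIV f g sequentially"
    using uniformly_convergent_eq_cauchy[of "\<lambda>_. True" f]
    unfolding uniform_limit_sequentially_iff by auto
  then obtain l where "f \<longlonglongrightarrow> l" by (rule uniform_limit_bcontfunE) simp
  thus "\<exists>l\<in>UNIV. f \<longlonglongrightarrow> l" by blast
qed

text \<open>The limit-periodic potentials form a closed subspace of a complete space, so Baire's
  theorem applies. Each \<open>fast_potentials l\<close> is open and contains the dense set of
  periodic potentials.\<close>

lemma generic_fast_potentials:
  defines "G \<equiv> limit_periodic \<inter> (\<Inter>l. fast_potentials l)"
  shows "gdelta_in (top_of_set limit_periodic) G"
    and "(top_of_set limit_periodic) closure_of G = limit_periodic"
proof -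
  let ?X = "top_of_set limit_periodic"
  let ?F = "range (\<lambda>l. limit_periodic \<inter> fast_potentials l)"
  have G: "G = \<Inter>?F" by (auto simp: G_def)
  have op: "openin ?X (limit_periodic \<inter> fast_potentials l)" for l
    using open_fast_potentials by (auto simp: openin_open)
  show "gdelta_in ?X G" unfolding G
    by (rule gdelta_in_Inter) (auto intro!: open_imp_gdelta_in op)
  have "completely_metrizable_space ?X"
  proof (rule completely_metrizable_space_closedin)
    show "completely_metrizable_space (euclidean :: (int \<Rightarrow>\<^sub>C real) topology)"
      using Met_TC.completely_metrizable_space_mtopology complete_UNIV_bcontfun by auto
  qed (simp add: limit_periodic_closure)
  moreover have "?X closure_of (limit_periodic \<inter> fast_potentials l) = topspace ?X" for l
  proof -
    have "closure {V. periodic V} \<subseteq> closure (limit_periodic \<inter> fast_potentials l)"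
      by (intro closure_mono) (auto simp: periodic_fast_potentials limit_periodic_closure intro: closure_subset[THEN subsetD])
    thus ?thesis by (auto simp: closure_of_subtopology limit_periodic_closure[symmetric] Int_absorb1)
  qed
  ultimately have "?X closure_of \<Inter>?F = topspace ?X"
    by (intro Baire_category) (auto simp: op)
  thus "?X closure_of G = limit_periodic" unfolding G by simp
qed


subsection \<open>Moments\<close>

lemma has_sum_norm_ell2: "((\<lambda>n. (cmod (ell2_nth u n))\<^sup>2) has_sum (norm u)\<^sup>2) UNIV"
  unfolding norm_ell2_def
  using has_sum_infsum[OF ell2_summable[of u]] by (simp add: infsum_nonneg)

lemma has_sum_norm_weighted:
  assumes "in_domain u"
  shows "((\<lambda>n. (1 + \<bar>real_of_int n\<bar>)\<^sup>2 * (cmod (ell2_nth u n))\<^sup>2) has_sum (norm (weighted u))\<^sup>2) UNIV"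
  using has_sum_norm_ell2[of "weighted u"] by (simp add: norm_weighted_nth[OF assms] power_mult_distrib)

lemma summable_on_powr_exp:
  assumes "p > 0" "c > 0"
  shows "(\<lambda>n::int. \<bar>real_of_int n\<bar> powr p * exp (- c * \<bar>real_of_int n\<bar>)) summable_on UNIV"
proof (rule summable_on_comparison_test)
  let ?A = "(p / (c / 2)) powr p"
  show "(\<lambda>n::int. ?A * exp (- (c / 2) * \<bar>real_of_int n\<bar>)) summable_on UNIV"
    using assms by (intro summable_on_cmult_right summable_on_exp_decay) simp
  fix n :: int
  let ?x = "\<bar>real_of_int n\<bar>"
  have "?x powr p * exp (- c * ?x) \<le> ?A * exp (c / 2 * ?x) * exp (- c * ?x)"
    using assms by (intro mult_right_mono powr_le_exp) auto
  also have "\<dots> = ?A * exp (- (c / 2) * ?x)"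
    by (simp add: mult.assoc exp_add[symmetric] field_simps)
  finally show "?x powr p * exp (- c * ?x) \<le> ?A * exp (- (c / 2) * ?x)" .
qed simp

text \<open>The evolution multiplies the exponential bound by \<open>exp (t a)\<close>. For
  \<open>|n| >= (2 a / c) t\<close> this costs at most half of the decay, and squaring the modulus
  brings the rate back to \<open>c\<close>.\<close>

lemma light_cone:
  assumes "exp_decaying \<psi>"
  obtains K c L where "c > 0" "L > 0"
    "\<And>t n. \<lbrakk>t \<ge> 0; L * t \<le> \<bar>real_of_int n\<bar>\<rbrakk> \<Longrightarrow>
      (cmod (ell2_nth (evolution V t \<psi>) n))\<^sup>2 \<le> K * exp (- c * \<bar>real_of_int n\<bar>)"
    "\<And>t. t \<ge> 0 \<Longrightarrow> in_domain (evolution V t \<psi>)"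
proof -
  obtain K c where K: "K > 0" and c: "c > 0" and dec: "exp_bound K c \<psi>"
    using assms unfolding exp_decaying_def exp_bound_def by blast
  let ?a = "2 * exp c + norm V"
  let ?L = "2 * ?a / c"
  have a: "?a > 0" by (intro add_pos_nonneg) auto
  have ev: "exp_bound (exp (t * ?a) * K) c (evolution V t \<psi>)" if "t \<ge> 0" for t
    using evolution_exp_bound[OF dec _ order_refl that, of V] c by simp
  have "(cmod (ell2_nth (evolution V t \<psi>) n))\<^sup>2 \<le> K\<^sup>2 * exp (- c * \<bar>real_of_int n\<bar>)"
    if t: "t \<ge> 0" and n: "?L * t \<le> \<bar>real_of_int n\<bar>" for t n
  proof -
    let ?x = "\<bar>real_of_int n\<bar>"
    have "cmod (ell2_nth (evolution V t \<psi>) n) \<le> exp (t * ?a) * K * exp (- c * ?x)"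
      using ev[OF t] by (simp add: exp_bound_def)
    also have "\<dots> = K * exp (t * ?a - c * ?x)" by (simp add: exp_diff exp_minus field_simps)
    also have "t * ?a - c * ?x \<le> - (c / 2) * ?x" using n c by (simp add: field_simps)
    finally have "cmod (ell2_nth (evolution V t \<psi>) n) \<le> K * exp (- (c / 2) * ?x)" using K by simp
    hence "(cmod (ell2_nth (evolution V t \<psi>) n))\<^sup>2 \<le> (K * exp (- (c / 2) * ?x))\<^sup>2"
      by (intro power_mono) auto
    also have "\<dots> = K\<^sup>2 * exp (- c * ?x)"
      by (simp add: power_mult_distrib power2_eq_square exp_add[symmetric])
    finally show ?thesis .
  qed
  moreover have "in_domain (evolution V t \<psi>)" if "t \<ge> 0" for t
    using exp_bound_weighted[OF c] ev[OF that] by metis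
  ultimately show ?thesis using c a by (intro that[of c ?L "K\<^sup>2"]) auto
qed

text \<open>Inside the light cone the weight is at most \<open>(L t)^p\<close> and the total mass is
  conserved; the part outside contributes a bounded amount.\<close>

lemma moment_upper:
  assumes \<psi>: "exp_decaying \<psi>" and p: "p > 0"
  obtains C where "C > 0" "\<And>t. t \<ge> 1 \<Longrightarrow> moment p (evolution V t \<psi>) \<le> C * t powr p"
proof -
  obtain K c L where c: "c > 0" and L: "L > 0" and cone:
    "\<And>t n. \<lbrakk>t \<ge> 0; L * t \<le> \<bar>real_of_int n\<bar>\<rbrakk> \<Longrightarrow>
      (cmod (ell2_nth (evolution V t \<psi>) n))\<^sup>2 \<le> K * exp (- c * \<bar>real_of_int n\<bar>)"
    using light_cone[OF \<psi>, where V = V] by metis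
  define E where "E = \<bar>K\<bar> * (\<Sum>\<^sub>\<infinity>n::int. \<bar>real_of_int n\<bar> powr p * exp (- c * \<bar>real_of_int n\<bar>))"
  have E: "((\<lambda>n::int. \<bar>K\<bar> * (\<bar>real_of_int n\<bar> powr p * exp (- c * \<bar>real_of_int n\<bar>))) has_sum E) UNIV"
    unfolding E_def by (intro has_sum_cmult_right has_sum_infsum summable_on_powr_exp p c)
  have E0: "E \<ge> 0" unfolding E_def by (intro mult_nonneg_nonneg infsum_nonneg) auto
  let ?C = "L powr p * (norm \<psi>)\<^sup>2 + E + 1"
  have "moment p (evolution V t \<psi>) \<le> ?C * t powr p" if t: "t \<ge> 1" for t
  proof -
    let ?\<phi> = "ell2_nth (evolution V t \<psi>)"
    have "moment p (evolution V t \<psi>) \<le> (L * t) powr p * (norm \<psi>)\<^sup>2 + E"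
    proof (rule has_sum_mono[OF moment_evolution(2)[OF \<psi> p]])
      show "((\<lambda>n. (L * t) powr p * (cmod (?\<phi> n))\<^sup>2
          + \<bar>K\<bar> * (\<bar>real_of_int n\<bar> powr p * exp (- c * \<bar>real_of_int n\<bar>)))
          has_sum (L * t) powr p * (norm \<psi>)\<^sup>2 + E) UNIV"
        using has_sum_norm_ell2[of "evolution V t \<psi>"]
        by (intro has_sum_add has_sum_cmult_right E) simp
      fix n :: int
      let ?x = "\<bar>real_of_int n\<bar>"
      show "?x powr p * (cmod (?\<phi> n))\<^sup>2 \<le> (L * t) powr p * (cmod (?\<phi> n))\<^sup>2
          + \<bar>K\<bar> * (?x powr p * exp (- c * ?x))"
      proof (cases "L * t \<le> ?x")
        case True
        have "(cmod (?\<phi> n))\<^sup>2 \<le> K * exp (- c * ?x)" using cone[of t n] True t by simp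
        also have "\<dots> \<le> \<bar>K\<bar> * exp (- c * ?x)" by (intro mult_right_mono) auto
        finally have "?x powr p * (cmod (?\<phi> n))\<^sup>2 \<le> ?x powr p * (\<bar>K\<bar> * exp (- c * ?x))"
          by (intro mult_left_mono) auto
        also have "\<dots> = \<bar>K\<bar> * (?x powr p * exp (- c * ?x))" by (rule mult.left_commute)
        finally show ?thesis by (rule add_increasing[rotated]) simp
      next
        case False
        hence "?x powr p * (cmod (?\<phi> n))\<^sup>2 \<le> (L * t) powr p * (cmod (?\<phi> n))\<^sup>2"
          using p by (intro mult_right_mono powr_mono2) auto
        moreover have "0 \<le> \<bar>K\<bar> * (?x powr p * exp (- c * ?x))" by simp
        ultimately show ?thesis by linarith
      qed
    qed
    also have "\<dots> = L powr p * (norm \<psi>)\<^sup>2 * t powr p + E * 1" using L t by (simp add: powr_mult)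
    also have "\<dots> \<le> L powr p * (norm \<psi>)\<^sup>2 * t powr p + E * t powr p"
      using E0 t p by (intro add_left_mono mult_left_mono ge_one_powr_ge_zero) auto
    also have "\<dots> \<le> ?C * t powr p" by (simp add: algebra_simps)
    finally show ?thesis .
  qed
  moreover have "?C > 0" using E0 by (intro add_nonneg_pos add_nonneg_nonneg) auto
  ultimately show ?thesis by (intro that[of ?C]) auto
qed

text \<open>On the shell \<open>s \<le> \<bar>n\<bar> < L t\<close> one has \<open>n\<^sup>2 \<le> (L t)\<^sup>2 s\<^sup>-\<^sup>p \<bar>n\<bar>\<^sup>p\<close>, so for every \<open>p\<close> the
  \<open>p\<close>-th moment inherits the growth of the second one.\<close>

lemma moment_lower:
  assumes \<psi>: "exp_decaying \<psi>" and p: "p > 0"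
  obtains L E where "L > 0" "\<And>t s. \<lbrakk>t > 0; s > 0\<rbrakk> \<Longrightarrow>
    (norm (weighted (evolution V t \<psi>)))\<^sup>2
      \<le> 2 * s\<^sup>2 * (norm \<psi>)\<^sup>2 + 2 * ((L * t)\<^sup>2 / s powr p * moment p (evolution V t \<psi>)) + E"
proof -
  obtain K c L where c: "c > 0" and L: "L > 0" and cone:
    "\<And>t n. \<lbrakk>t \<ge> 0; L * t \<le> \<bar>real_of_int n\<bar>\<rbrakk> \<Longrightarrow>
      (cmod (ell2_nth (evolution V t \<psi>) n))\<^sup>2 \<le> K * exp (- c * \<bar>real_of_int n\<bar>)"
    and dom: "\<And>t. t \<ge> 0 \<Longrightarrow> in_domain (evolution V t \<psi>)"
    using light_cone[OF \<psi>, where V = V] by metis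
  define E where "E = \<bar>K\<bar> * (\<Sum>\<^sub>\<infinity>n::int. \<bar>real_of_int n\<bar> powr 2 * exp (- c * \<bar>real_of_int n\<bar>))"
  have E: "((\<lambda>n::int. \<bar>K\<bar> * (\<bar>real_of_int n\<bar> powr 2 * exp (- c * \<bar>real_of_int n\<bar>))) has_sum E) UNIV"
    unfolding E_def by (intro has_sum_cmult_right has_sum_infsum summable_on_powr_exp c) simp
  have "(norm (weighted (evolution V t \<psi>)))\<^sup>2
      \<le> 2 * s\<^sup>2 * (norm \<psi>)\<^sup>2 + 2 * ((L * t)\<^sup>2 / s powr p * moment p (evolution V t \<psi>)) + (2 * (norm \<psi>)\<^sup>2 + 2 * E)"
    if t: "t > 0" and s: "s > 0" for t s
  proof -
    let ?\<phi> = "ell2_nth (evolution V t \<psi>)"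
    let ?D = "(L * t)\<^sup>2 / s powr p"
    have D: "?D \<ge> 0" by simp
    have "(norm (weighted (evolution V t \<psi>)))\<^sup>2 \<le> 2 * (norm \<psi>)\<^sup>2
      + 2 * (s\<^sup>2 * (norm \<psi>)\<^sup>2 + ?D * moment p (evolution V t \<psi>) + E)"
    proof (rule has_sum_mono[OF has_sum_norm_weighted[OF dom]])
      show "((\<lambda>n. 2 * (cmod (?\<phi> n))\<^sup>2 + 2 * (s\<^sup>2 * (cmod (?\<phi> n))\<^sup>2
          + ?D * (\<bar>real_of_int n\<bar> powr p * (cmod (?\<phi> n))\<^sup>2)
          + \<bar>K\<bar> * (\<bar>real_of_int n\<bar> powr 2 * exp (- c * \<bar>real_of_int n\<bar>))))
          has_sum 2 * (norm \<psi>)\<^sup>2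
            + 2 * (s\<^sup>2 * (norm \<psi>)\<^sup>2 + ?D * moment p (evolution V t \<psi>) + E)) UNIV"
        using has_sum_norm_ell2[of "evolution V t \<psi>"]
        by (intro has_sum_add has_sum_cmult_right E moment_evolution(2) \<psi> p) simp_all
      fix n :: int
      let ?x = "\<bar>real_of_int n\<bar>" and ?m = "(cmod (?\<phi> n))\<^sup>2"
      have "?x\<^sup>2 * ?m \<le> s\<^sup>2 * ?m + ?D * (?x powr p * ?m) + \<bar>K\<bar> * (?x powr 2 * exp (- c * ?x))"
      proof -
        have nn: "0 \<le> s\<^sup>2 * ?m" "0 \<le> ?D * (?x powr p * ?m)" "0 \<le> \<bar>K\<bar> * (?x powr 2 * exp (- c * ?x))"
          using D by (auto intro!: mult_nonneg_nonneg)
        \<comment> \<open>Outside the cone the exponential tail suffices, and in the core the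
          conserved mass does. On the shell, \<open>?x^2 <= (L t)^2\<close> is combined with
          \<open>1 <= (?x / s)^p\<close>.\<close>
        consider "L * t \<le> ?x" | "?x < s" | "s \<le> ?x" "?x < L * t" by linarith
        thus ?thesis
        proof cases
          case 1
          have "?m \<le> K * exp (- c * ?x)" using cone[of t n] 1 t by simp
          also have "\<dots> \<le> \<bar>K\<bar> * exp (- c * ?x)" by (intro mult_right_mono) auto
          finally have "?x\<^sup>2 * ?m \<le> ?x\<^sup>2 * (\<bar>K\<bar> * exp (- c * ?x))" by (intro mult_left_mono) auto
          also have "\<dots> = \<bar>K\<bar> * (?x powr 2 * exp (- c * ?x))" by (simp add: mult_ac)
          finally show ?thesis using nn by linarith
        next
          case 2
          hence "?x\<^sup>2 * ?m \<le> s\<^sup>2 * ?m" by (intro mult_right_mono power_mono) auto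
          thus ?thesis using nn by linarith
        next
          case 3
          have "?x\<^sup>2 * 1 \<le> (L * t)\<^sup>2 * (?x powr p / s powr p)"
            using 3 s p by (intro mult_mono power_mono) (auto simp: powr_mono2)
          hence "?x\<^sup>2 \<le> ?D * ?x powr p" by (simp add: mult_ac)
          hence "?x\<^sup>2 * ?m \<le> ?D * ?x powr p * ?m" by (intro mult_right_mono) auto
          thus ?thesis using nn by (simp only: mult.assoc)
        qed
      qed
      hence "2 * ?m + 2 * (?x\<^sup>2 * ?m) \<le> 2 * ?m + 2 * (s\<^sup>2 * ?m + ?D * (?x powr p * ?m)
          + \<bar>K\<bar> * (?x powr 2 * exp (- c * ?x)))"
        by (intro add_left_mono mult_left_mono) simp_all
      moreover have "(1 + ?x)\<^sup>2 * ?m \<le> (2 + 2 * ?x\<^sup>2) * ?m"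
        using zero_le_power2[of "1 - ?x"] by (intro mult_right_mono) (simp_all add: power2_eq_square algebra_simps)
      hence "(1 + ?x)\<^sup>2 * ?m \<le> 2 * ?m + 2 * (?x\<^sup>2 * ?m)" by (simp only: distrib_right mult.assoc)
      ultimately show "(1 + ?x)\<^sup>2 * ?m \<le> 2 * ?m + 2 * (s\<^sup>2 * ?m + ?D * (?x powr p * ?m)
          + \<bar>K\<bar> * (?x powr 2 * exp (- c * ?x)))"
        by (rule order_trans[rotated])
    qed (use t in simp)
    thus ?thesis by (simp add: algebra_simps)
  qed
  with L show ?thesis by (rule that)
qed

section \<open>The transport exponent\<close>

lemma beta_upper_le_1:
  assumes \<psi>: "exp_decaying \<psi>" and p: "p > 0"
  shows "beta_upper V \<psi> p \<le> 1"
proof -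
  obtain C where C: "C > 0" and M: "\<And>t. t \<ge> 1 \<Longrightarrow> moment p (evolution V t \<psi>) \<le> C * t powr p"
    using moment_upper[OF \<psi> p] by metis
  let ?g = "\<lambda>t. ln (C * t powr p) / (p * ln t)"
  have "(?g \<longlongrightarrow> 1) at_top" using C p by real_asymp
  hence "((\<lambda>t. ereal (?g t)) \<longlongrightarrow> 1) at_top" by (simp add: one_ereal_def)
  hence lim: "Limsup at_top (\<lambda>t. ereal (?g t)) = 1" by (intro lim_imp_Limsup) auto
  have "log_ereal (moment p (evolution V t \<psi>)) / ereal (p * ln t) \<le> ereal (?g t)" if t: "t > 1" for t
  proof (cases "moment p (evolution V t \<psi>) > 0")
    case True
    hence "ln (moment p (evolution V t \<psi>)) \<le> ln (C * t powr p)" using M[of t] t by simp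
    thus ?thesis using True t p by (simp add: log_ereal_def divide_right_mono)
  next
    \<comment> \<open>The logarithm is minus infinity here and stays so after division by the
      positive number \<open>p * ln t\<close>.\<close>
    case False
    have "p * ln t > 0" using t p by simp
    thus ?thesis using False by (simp add: log_ereal_def)
  qed
  hence "beta_upper V \<psi> p \<le> Limsup at_top (\<lambda>t. ereal (?g t))"
    unfolding beta_upper_def by (intro Limsup_mono eventually_mono[OF eventually_gt_at_top[of 1]])
  thus ?thesis using lim by simp
qed

text \<open>Since the exponent is an upper limit, growth along some unbounded set of times suffices,
  and a loss of powers of \<open>ln T\<close> does not change it.\<close>

lemma beta_upper_ge_1:
  assumes \<psi>: "exp_decaying \<psi>" "\<psi> \<noteq> 0" and p: "p > 0"
    and fast: "\<exists>\<^sub>F T in at_top. T / ln T \<le> norm (weighted (evolution V T \<psi>))"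
  shows "1 \<le> beta_upper V \<psi> p"
proof -
  obtain L E where L: "L > 0" and M: "\<And>t s. \<lbrakk>t > 0; s > 0\<rbrakk> \<Longrightarrow>
    (norm (weighted (evolution V t \<psi>)))\<^sup>2
      \<le> 2 * s\<^sup>2 * (norm \<psi>)\<^sup>2 + 2 * ((L * t)\<^sup>2 / s powr p * moment p (evolution V t \<psi>)) + E"
    using moment_lower[OF \<psi>(1) p] by metis
  \<comment> \<open>Chosen so that \<open>s = t / (a ln t)\<close> turns the core term
    \<open>2 s^2 |\<psi>|^2\<close> into half of \<open>(t / ln t)^2\<close>.\<close>
  define a where "a = 2 * norm \<psi>"
  have a: "a > 0" using \<psi>(2) by (simp add: a_def)
  \<comment> \<open>The lower bound on the moment obtained by solving the estimate for it; it is of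
    order \<open>t^p / (ln t)^(p + 2)\<close>.\<close>
  define h where "h t = (t / (a * ln t)) powr p * ((t / ln t)\<^sup>2 / 2 - E) / (2 * (L * t)\<^sup>2)" for t
  have hM: "h t \<le> moment p (evolution V t \<psi>)"
    if t: "t > 1" and w: "t / ln t \<le> norm (weighted (evolution V t \<psi>))" for t
  proof -
    define s where "s = t / (a * ln t)"
    have s: "s > 0" using t a by (simp add: s_def)
    have "(t / ln t)\<^sup>2 \<le> (norm (weighted (evolution V t \<psi>)))\<^sup>2" using w t by (intro power_mono) auto
    also have "\<dots> \<le> 2 * s\<^sup>2 * (norm \<psi>)\<^sup>2 + 2 * ((L * t)\<^sup>2 / s powr p * moment p (evolution V t \<psi>)) + E"
      using M s t by simp
    also have "2 * s\<^sup>2 * (norm \<psi>)\<^sup>2 = (t / ln t)\<^sup>2 / 2"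
      using \<psi>(2) by (simp add: s_def a_def power_divide power_mult_distrib)
    finally have "(t / ln t)\<^sup>2 / 2 - E \<le> 2 * (L * t)\<^sup>2 / s powr p * moment p (evolution V t \<psi>)" by simp
    hence "s powr p * ((t / ln t)\<^sup>2 / 2 - E) \<le> 2 * (L * t)\<^sup>2 * moment p (evolution V t \<psi>)"
      using s by (simp add: field_simps)
    thus ?thesis unfolding h_def s_def[symmetric]
      using L t by (subst pos_divide_le_eq) (simp_all add: mult_ac)
  qed
  let ?g = "\<lambda>t. ln (h t) / (p * ln t)"
  have "(?g \<longlongrightarrow> 1) at_top" unfolding h_def using L a p by real_asymp
  hence lim: "((\<lambda>t. ereal (?g t)) \<longlongrightarrow> 1) at_top" by (simp add: one_ereal_def)
  have pos: "\<forall>\<^sub>F t in at_top. h t > 0" unfolding h_def using L a p by real_asymp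
  let ?f = "\<lambda>t. log_ereal (moment p (evolution V t \<psi>)) / ereal (p * ln t)"
  show ?thesis
  proof (rule ccontr)
    assume "\<not> ?thesis"
    then obtain y where y: "Limsup at_top ?f < y" "y < 1"
      using dense[of "Limsup at_top ?f" 1] by (auto simp: beta_upper_def not_le)
    have "\<forall>\<^sub>F t in at_top. ?f t < y" using y(1) by (rule Limsup_lessD)
    moreover have "\<forall>\<^sub>F t in at_top. y < ereal (?g t)" by (rule order_tendstoD(1)[OF lim y(2)])
    ultimately have "\<forall>\<^sub>F t in at_top. t > 1 \<and> h t > 0 \<and> ?f t < ereal (?g t)"
      using pos eventually_gt_at_top[of 1] by eventually_elim auto
    from frequently_ex[OF frequently_eventually_conj[OF fast this]]
    obtain t where t: "t > 1" "h t > 0" "?f t < ereal (?g t)"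
      and w: "t / ln t \<le> norm (weighted (evolution V t \<psi>))" by blast
    have "h t \<le> moment p (evolution V t \<psi>)" using hM t(1) w by blast
    hence "ln (h t) \<le> ln (moment p (evolution V t \<psi>))" "moment p (evolution V t \<psi>) > 0"
      using t(2) by auto
    hence "ereal (?g t) \<le> ?f t"
      using t(1) p by (simp add: log_ereal_def divide_right_mono)
    thus False using t(3) by auto
  qed
qed

theorem theorem1p7:
  shows "\<exists>G :: (int \<Rightarrow>\<^sub>C real) set. gdelta_in (top_of_set limit_periodic) G
           \<and> (top_of_set limit_periodic) closure_of G = limit_periodic
           \<and> (\<forall>V\<in>G. \<forall>p>0::real. \<forall>\<psi> :: ell2. exp_decaying \<psi> \<and> \<psi> \<noteq> 0 \<longrightarrow> beta_upper V \<psi> p = 1)"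
proof (intro exI conjI ballI allI impI)
  show "gdelta_in (top_of_set limit_periodic) (limit_periodic \<inter> (\<Inter>l. fast_potentials l))"
    and "(top_of_set limit_periodic) closure_of (limit_periodic \<inter> (\<Inter>l. fast_potentials l)) = limit_periodic"
    by (fact generic_fast_potentials)+
  fix V p \<psi>
  assume V: "V \<in> limit_periodic \<inter> (\<Inter>l. fast_potentials l)" and p: "p > (0::real)"
    and \<psi>: "exp_decaying \<psi> \<and> \<psi> \<noteq> 0"
  obtain l0 where l0: "\<And>l. l \<ge> l0 \<Longrightarrow> \<psi> \<in> initial_states l"
    using exp_decaying_initial_states \<psi> by metis
  have "\<exists>\<^sub>F T in at_top. T / ln T \<le> norm (weighted (evolution V T \<psi>))"
  proof (rule ccontr)
    assume "\<not> ?thesis"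
    then obtain x where x: "\<And>T. T > x \<Longrightarrow> \<not> T / ln T \<le> norm (weighted (evolution V T \<psi>))"
      by (auto simp: frequently_def eventually_at_top_dense)
    \<comment> \<open>The index \<open>max k l0\<close> serves two purposes: \<open>k\<close> pushes
      the time beyond \<open>x\<close>, and \<open>l0\<close> puts \<open>\<psi>\<close> into the
      class of states.\<close>
    obtain k where "x \<le> real k" using real_arch_simple by blast
    hence l: "x \<le> real (max k l0)" by simp
    have "V \<in> fast_potentials (max k l0)" using V by blast
    then obtain T \<eta> where T: "T > real (max k l0)" "\<eta> > 0"
      "T / ln T + \<eta> \<le> norm (weighted (evolution V T \<psi>))"
      using l0[of "max k l0"] unfolding fast_potentials_def by auto
    hence "T / ln T \<le> norm (weighted (evolution V T \<psi>))" by linarith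
    thus False using x[of T] T(1) l by linarith
  qed
  thus "beta_upper V \<psi> p = 1"
    using beta_upper_le_1 beta_upper_ge_1 \<psi> p by (intro antisym) auto
qed

end
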